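(* Let $F$ be a field, $n\ge 1$, and let $c$ be a reduced skew set of degree $n$ over $F$. Let $N=\mathfrak{N}(M_n(F;c))$ be the nucleus of the skew matrix algebra $M_n(F;c)$, let $\mathrm{J}(N)$ be its Jacobson radical, and let $S\subseteq N$ be the subspace spanned by the matrix units $e_{ij}\in N$ for which $c_{iji}\ne 0$. Then $$\mathfrak{N}(M_n(F;c)) = S\oplus \mathrm{J}(\mathfrak{N}(M_n(F;c)))$$ (as vector spaces), where $S$ is a partition subalgebra, namely a direct sum of matrix algebras over $F$, whose sum of degrees is $n$.
   Context: A skew set of degree $n$ over $F$ is a family $c=(c_{ijk})_{1\le i,j,k\le n}$ of scalars in $F$ (zeros allowed); it is reduced if $c_{iij}=c_{ijj}=1$ for all $i,j$. The skew matrix algebra $M_n(F;c)$ is the (in general nonassociative) $F$-algebra with basis $\{e_{ij}\}_{1\le i,j\le n}$ and multiplication $e_{ij}e_{k\ell}=\delta_{jk}c_{ij\ell}e_{i\ell}$. The associator is $(x,y,z)=(xy)z-x(yz)$; the nucleus $\mathfrak{N}(A)$ of an algebra $A$ is the set of $x\in A$ with $(x,A,A)=(A,x,A)=(A,A,x)=0$; it is an associative subalgebra. For an equivalence relation $\equiv$ on $\{1,\dots,n\}$, the span of the $e_{ij}$ with $i\equiv j$ is a unital subalgebra of $M_n(F;c)$; subalgebras of this form are called partition subalgebras. The degree of the matrix algebra $M_m(F)$ is $m$. *)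

theory Defs
  imports
    "Jordan_Normal_Form.VS_Connect"
    "HOL-Algebra.Chinese_Remainder"
begin

text \<open>
  Indices run over \<open>{..<n}\<close> instead of \<open>{1..n}\<close>.  A skew set of degree \<open>n\<close> is a function
  \<open>c :: nat \<Rightarrow> nat \<Rightarrow> nat \<Rightarrow> 'a\<close> of which only the values at indices below \<open>n\<close> matter.  The scalars
  are the type class field \<open>'a\<close>, seen as a record through \<^term>\<open>class_ring\<close>.
\<close>

definition reduced_skew_set :: "nat \<Rightarrow> (nat \<Rightarrow> nat \<Rightarrow> nat \<Rightarrow> 'a :: field) \<Rightarrow> bool" where
  "reduced_skew_set n c \<longleftrightarrow> (\<forall>i<n. \<forall>j<n. c i i j = 1 \<and> c i j j = 1)"

definition mat_unit :: "nat \<Rightarrow> nat \<Rightarrow> nat \<Rightarrow> 'a :: field mat" where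
  "mat_unit n i j = mat n n (\<lambda>(k, l). if k = i \<and> l = j then 1 else 0)"

definition skew_mult ::
  "nat \<Rightarrow> (nat \<Rightarrow> nat \<Rightarrow> nat \<Rightarrow> 'a :: field) \<Rightarrow> 'a mat \<Rightarrow> 'a mat \<Rightarrow> 'a mat" where
  "skew_mult n c A B =
     mat n n (\<lambda>(i, l). \<Sum>j<n. c i j l * (A $$ (i, j) * B $$ (j, l)))"

text \<open>
  The product is the bilinear extension of the multiplication table of the matrix units, see
  \<open>skew_mult_mat_unit\<close> below.  It is nonassociative in general, so the record is in general not a
  ring in the sense of the locale \<^locale>\<open>ring\<close>; its field \<open>one\<close> is a unit element if \<open>c\<close> is reduced.
\<close>

definition skew_matrix_algebra ::
  "nat \<Rightarrow> (nat \<Rightarrow> nat \<Rightarrow> nat \<Rightarrow> 'a :: field) \<Rightarrow> ('a, 'a mat) module" where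
  "skew_matrix_algebra n c =
     \<lparr>carrier = carrier_mat n n, mult = skew_mult n c, one = 1\<^sub>m n, zero = 0\<^sub>m n n,
      add = (+), smult = (\<cdot>\<^sub>m)\<rparr>"

lemma skew_mult_mat_unit:
  assumes "i < n" "j < n" "k < n" "l < n"
  shows "skew_mult n c (mat_unit n i j) (mat_unit n k l) =
    (if j = k then c i j l \<cdot>\<^sub>m mat_unit n i l else 0\<^sub>m n n)"
proof -
  have "(\<Sum>x<n. c r x s * ((if r = i \<and> x = j then 1 else 0) * (if x = k \<and> s = l then 1 else 0)))
      = (if r = i \<and> s = l \<and> j = k then c i j l else 0)" for r s
  proof -
    have "(\<Sum>x<n. c r x s * ((if r = i \<and> x = j then 1 else 0) * (if x = k \<and> s = l then 1 else 0)))
      = (\<Sum>x<n. if x = j then (if r = i \<and> s = l \<and> j = k then c i j l else 0) else 0)"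
      by (rule sum.cong) auto
    then show ?thesis
      using assms by (simp add: sum.delta)
  qed
  then show ?thesis
    by (intro eq_matI) (auto simp: skew_mult_def mat_unit_def)
qed

lemma skew_mult_one:
  assumes "reduced_skew_set n c" "A \<in> carrier_mat n n"
  shows "skew_mult n c (1\<^sub>m n) A = A" and "skew_mult n c A (1\<^sub>m n) = A"
proof -
  have "(\<Sum>j<n. c i j l * ((if i = j then 1 else 0) * A $$ (j, l))) = A $$ (i, l)"
    if "i < n" "l < n" for i l
  proof -
    have "(\<Sum>j<n. c i j l * ((if i = j then 1 else 0) * A $$ (j, l)))
        = (\<Sum>j<n. if j = i then A $$ (i, l) else 0)"
      using assms(1) that by (intro sum.cong) (auto simp: reduced_skew_set_def)
    then show ?thesis using that by simp
  qed
  then show "skew_mult n c (1\<^sub>m n) A = A"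
    using assms(2) by (intro eq_matI) (auto simp: skew_mult_def)
  have "(\<Sum>j<n. c i j l * (A $$ (i, j) * (if j = l then 1 else 0))) = A $$ (i, l)"
    if "i < n" "l < n" for i l
  proof -
    have "(\<Sum>j<n. c i j l * (A $$ (i, j) * (if j = l then 1 else 0)))
        = (\<Sum>j<n. if j = l then A $$ (i, l) else 0)"
      using assms(1) that by (intro sum.cong) (auto simp: reduced_skew_set_def)
    then show ?thesis using that by simp
  qed
  then show "skew_mult n c A (1\<^sub>m n) = A"
    using assms(2) by (intro eq_matI) (auto simp: skew_mult_def)
qed

definition associator ::
  "('b, 'm) ring_scheme \<Rightarrow> 'b \<Rightarrow> 'b \<Rightarrow> 'b \<Rightarrow> 'b" where
  "associator A x y z = ((x \<otimes>\<^bsub>A\<^esub> y) \<otimes>\<^bsub>A\<^esub> z) \<ominus>\<^bsub>A\<^esub> (x \<otimes>\<^bsub>A\<^esub> (y \<otimes>\<^bsub>A\<^esub> z))"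

definition nucleus :: "('b, 'm) ring_scheme \<Rightarrow> 'b set" where
  "nucleus A = {x \<in> carrier A. \<forall>y \<in> carrier A. \<forall>z \<in> carrier A.
     associator A x y z = \<zero>\<^bsub>A\<^esub> \<and> associator A y x z = \<zero>\<^bsub>A\<^esub> \<and> associator A y z x = \<zero>\<^bsub>A\<^esub>}"

abbreviation nucleus_algebra :: "('a, 'b) module \<Rightarrow> ('a, 'b) module" where
  "nucleus_algebra A \<equiv> A\<lparr>carrier := nucleus A\<rparr>"

definition left_ideal :: "'b set \<Rightarrow> ('b, 'm) ring_scheme \<Rightarrow> bool" where
  "left_ideal I R \<longleftrightarrow>
     additive_subgroup I R \<and> (\<forall>r \<in> carrier R. \<forall>x \<in> I. r \<otimes>\<^bsub>R\<^esub> x \<in> I)"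

definition maximal_left_ideal :: "'b set \<Rightarrow> ('b, 'm) ring_scheme \<Rightarrow> bool" where
  "maximal_left_ideal I R \<longleftrightarrow>
     left_ideal I R \<and> I \<noteq> carrier R \<and>
     (\<forall>J. left_ideal J R \<and> I \<subseteq> J \<longrightarrow> J = I \<or> J = carrier R)"

text \<open>The intersection of all maximal left ideals of a (not necessarily commutative) unital ring.\<close>

definition jacobson_radical :: "('b, 'm) ring_scheme \<Rightarrow> 'b set" where
  "jacobson_radical R = {x \<in> carrier R. \<forall>I. maximal_left_ideal I R \<longrightarrow> x \<in> I}"

abbreviation lin_span :: "('a :: field, 'b) module \<Rightarrow> 'b set \<Rightarrow> 'b set" where
  "lin_span V X \<equiv> LinearCombinations.module.span class_ring V X"

definition internal_direct_sum :: "('a :: field, 'b) module \<Rightarrow> 'b set \<Rightarrow> 'b set \<Rightarrow> bool" where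
  "internal_direct_sum V U W \<longleftrightarrow>
     VectorSpace.subspace class_ring U V \<and> VectorSpace.subspace class_ring W V \<and>
     LinearCombinations.module.submodule_sum V U W = carrier V \<and> U \<inter> W = {\<zero>\<^bsub>V\<^esub>}"

definition unital_subalgebra :: "'b set \<Rightarrow> ('a :: field, 'b) module \<Rightarrow> bool" where
  "unital_subalgebra B A \<longleftrightarrow>
     VectorSpace.subspace class_ring B A \<and> \<one>\<^bsub>A\<^esub> \<in> B \<and> (\<forall>x \<in> B. \<forall>y \<in> B. x \<otimes>\<^bsub>A\<^esub> y \<in> B)"

definition partition_subalgebra ::
  "nat \<Rightarrow> (nat \<Rightarrow> nat \<Rightarrow> nat \<Rightarrow> 'a :: field) \<Rightarrow> 'a mat set \<Rightarrow> bool" where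
  "partition_subalgebra n c B \<longleftrightarrow>
     unital_subalgebra B (skew_matrix_algebra n c) \<and>
     (\<exists>r. equiv {..<n} r \<and>
        B = lin_span (skew_matrix_algebra n c) {mat_unit n i j | i j. (i, j) \<in> r})"

text \<open>
  The direct sum of the matrix algebras of degrees \<open>m\<^sub>1, \<dots>, m\<^sub>r\<close>, where \<open>ms = [m\<^sub>1, \<dots>, m\<^sub>r]\<close>:
  its elements are the lists \<open>[X\<^sub>1, \<dots>, X\<^sub>r]\<close> with \<open>X\<^sub>k\<close> of size \<open>m\<^sub>k \<times> m\<^sub>k\<close>, and all operations
  are componentwise.
\<close>

definition matrix_algebras_sum :: "nat list \<Rightarrow> ('a :: field, 'a mat list) module" where
  "matrix_algebras_sum ms =
     ring.extend (RDirProd_list (map (\<lambda>m. ring_mat TYPE('a) m ()) ms))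
       \<lparr>smult = (\<lambda>a Xs. map (\<lambda>X. a \<cdot>\<^sub>m X) Xs)\<rparr>"

text \<open>Bijective \<open>F\<close>-linear maps that respect products and unit elements.\<close>

definition algebra_iso :: "('a :: field, 'b) module \<Rightarrow> ('a, 'd) module \<Rightarrow> ('b \<Rightarrow> 'd) set" where
  "algebra_iso A B = ring_iso A B \<inter> LinearCombinations.module_hom class_ring A B"

end

theory Submission
  imports Defs
begin

text \<open>
  Associativity conditions on a matrix with entry at \<open>(i, j)\<close> nonzero only involve cocycle identities
  for \<open>c\<close> at \<open>(i, j)\<close>, so the nucleus is spanned by the matrix units it contains.  The cocycle
  identities show that the nuclear units \<open>e\<^sub>i\<^sub>j\<close> with \<open>c\<^sub>i\<^sub>j\<^sub>i \<noteq> 0\<close> come from an equivalence relation,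
  and that a nuclear product landing on such a unit only has factors of this kind.  Hence the other nuclear
  units span an ideal; it lies in every maximal left ideal by a nilpotency argument, and conversely it
  contains the radical because, for each column, the matrices vanishing at the related positions of
  that column form a maximal left ideal.  On the equivalence classes the multiplication is a
  rescaling of matrix multiplication.
\<close>

section \<open>Matrix units and matrices supported on a set of positions\<close>

lemma mat_unit_carrier [simp]: "mat_unit n i j \<in> carrier_mat n n"
  by (simp add: mat_unit_def)

lemma mat_unit_index [simp]:
  "k < n \<Longrightarrow> l < n \<Longrightarrow> mat_unit n i j $$ (k, l) = (if k = i \<and> l = j then 1 else 0)"
  by (simp add: mat_unit_def)

text \<open>The nucleus, the span \<open>S\<close>, the radical and the maximal left ideals of
  \<open>maximal_left_ideal_column\<close> all take this form, so questions about them become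
  questions about sets of index pairs. Pairs outside the index range have no effect, and
  \<open>r = UNIV\<close> gives all matrices.\<close>

definition supp_mat :: "nat \<Rightarrow> (nat \<times> nat) set \<Rightarrow> 'a :: field mat set" where
  "supp_mat n r = {X \<in> carrier_mat n n. \<forall>i<n. \<forall>j<n. X $$ (i, j) \<noteq> 0 \<longrightarrow> (i, j) \<in> r}"

lemma supp_matI:
  "X \<in> carrier_mat n n \<Longrightarrow>
    (\<And>i j. i < n \<Longrightarrow> j < n \<Longrightarrow> X $$ (i, j) \<noteq> 0 \<Longrightarrow> (i, j) \<in> r) \<Longrightarrow> X \<in> supp_mat n r"
  by (auto simp: supp_mat_def)

lemma supp_mat_carrier: "X \<in> supp_mat n r \<Longrightarrow> X \<in> carrier_mat n n"
  by (auto simp: supp_mat_def)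

lemma supp_matD:
  "X \<in> supp_mat n r \<Longrightarrow> i < n \<Longrightarrow> j < n \<Longrightarrow> X $$ (i, j) \<noteq> 0 \<Longrightarrow> (i, j) \<in> r"
  by (auto simp: supp_mat_def)

lemma supp_mat_mono: "r \<subseteq> s \<Longrightarrow> supp_mat n r \<subseteq> supp_mat n s"
  by (auto simp: supp_mat_def)

lemma supp_mat_UNIV: "supp_mat n UNIV = carrier_mat n n"
  by (auto simp: supp_mat_def)

lemma zero_supp_mat [simp]: "0\<^sub>m n n \<in> supp_mat n r"
  by (auto simp: supp_mat_def)

lemma add_supp_mat: "X \<in> supp_mat n r \<Longrightarrow> Y \<in> supp_mat n r \<Longrightarrow> X + Y \<in> supp_mat n r"
  unfolding supp_mat_def by (auto; metis add_0)

lemma smult_supp_mat: "X \<in> supp_mat n r \<Longrightarrow> a \<cdot>\<^sub>m X \<in> supp_mat n r"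
  unfolding supp_mat_def by auto

lemma uminus_supp_mat: "X \<in> supp_mat n r \<Longrightarrow> - X \<in> supp_mat n r"
  unfolding supp_mat_def by auto

lemma mat_unit_supp_mat: "(i, j) \<in> r \<Longrightarrow> mat_unit n i j \<in> supp_mat n r"
  by (auto simp: supp_mat_def split: if_splits)

text \<open>The entries of \<open>X\<close> are switched on one position at a time. Cutting
  \<open>r\<close> down to the index range makes this a finite induction.\<close>

lemma supp_mat_induct [consumes 1, case_names zero add]:
  fixes X :: "'a :: field mat"
  assumes X: "X \<in> supp_mat n r" and zero: "P (0\<^sub>m n n)"
    and add: "\<And>i j a Y. i < n \<Longrightarrow> j < n \<Longrightarrow> (i, j) \<in> r \<Longrightarrow> P Y \<Longrightarrow> P (a \<cdot>\<^sub>m mat_unit n i j + Y)"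
  shows "P X"
proof -
  let ?r = "r \<inter> {..<n} \<times> {..<n}"
  have fin: "finite ?r" by (rule finite_Int) simp
  have "P (mat n n (\<lambda>p. if p \<in> F then X $$ p else 0))" if "F \<subseteq> ?r" for F
    using finite_subset[OF that fin] that
  proof (induction F rule: finite_induct)
    case empty
    have "mat n n (\<lambda>p. if p \<in> {} then X $$ p else 0) = 0\<^sub>m n n"
      by (intro eq_matI) auto
    then show ?case using zero by (simp only:)
  next
    case (insert p F)
    obtain i j where p: "p = (i, j)" by force
    have eq: "mat n n (\<lambda>q. if q \<in> insert p F then X $$ q else 0)
      = X $$ p \<cdot>\<^sub>m mat_unit n i j + mat n n (\<lambda>q. if q \<in> F then X $$ q else 0)"
      using insert.hyps p by (intro eq_matI) (auto simp: mat_unit_def)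
    have "i < n" "j < n" "(i, j) \<in> r" and F: "F \<subseteq> ?r" using insert.prems p by auto
    then show ?case
      unfolding eq by (intro add insert.IH)
  qed
  from this[OF order_refl]
  have "P (mat n n (\<lambda>p. if p \<in> ?r then X $$ p else 0))" .
  also have "mat n n (\<lambda>p. if p \<in> ?r then X $$ p else 0) = X"
    using supp_mat_carrier[OF X] supp_matD[OF X] by (intro eq_matI) auto
  finally show ?thesis .
qed

section \<open>Linear structure of the skew matrix algebra and spans of matrix units\<close>

lemma skew_matrix_algebra_simps [simp]:
  "carrier (skew_matrix_algebra n c) = carrier_mat n n"
  "mult (skew_matrix_algebra n c) = skew_mult n c"
  "one (skew_matrix_algebra n c) = 1\<^sub>m n"
  "zero (skew_matrix_algebra n c) = 0\<^sub>m n n"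
  "add (skew_matrix_algebra n c) = (+)"
  "smult (skew_matrix_algebra n c) = (\<cdot>\<^sub>m)"
  by (simp_all add: skew_matrix_algebra_def)

lemma vectorspace_supp_mat:
  "vectorspace class_ring ((skew_matrix_algebra n c)\<lparr>carrier := supp_mat n r\<rparr>)"
proof (rule vs_criteria)
  let ?V = "(skew_matrix_algebra n c)\<lparr>carrier := supp_mat n r\<rparr>"
  show "\<forall>v\<in>carrier ?V. \<exists>w\<in>carrier ?V. v \<oplus>\<^bsub>?V\<^esub> w = \<zero>\<^bsub>?V\<^esub>"
  proof
    fix X assume "X \<in> carrier ?V"
    then show "\<exists>w\<in>carrier ?V. X \<oplus>\<^bsub>?V\<^esub> w = \<zero>\<^bsub>?V\<^esub>"
      using uminus_supp_mat[of X n r] supp_mat_carrier[of X n r]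
      by (auto intro!: bexI[of _ "- X"])
  qed
  show "\<forall>v w x. v \<in> carrier ?V \<and> w \<in> carrier ?V \<and> x \<in> carrier ?V \<longrightarrow>
      v \<oplus>\<^bsub>?V\<^esub> w \<oplus>\<^bsub>?V\<^esub> x = v \<oplus>\<^bsub>?V\<^esub> (w \<oplus>\<^bsub>?V\<^esub> x)"
    by (auto dest!: supp_mat_carrier intro: assoc_add_mat)
  show "\<forall>v w. v \<in> carrier ?V \<and> w \<in> carrier ?V \<longrightarrow> v \<oplus>\<^bsub>?V\<^esub> w = w \<oplus>\<^bsub>?V\<^esub> v"
    by (auto dest!: supp_mat_carrier intro: comm_add_mat)
  show "\<forall>a v w. a \<in> carrier class_ring \<and> v \<in> carrier ?V \<and> w \<in> carrier ?V \<longrightarrow>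
      a \<odot>\<^bsub>?V\<^esub> (v \<oplus>\<^bsub>?V\<^esub> w) = (a \<odot>\<^bsub>?V\<^esub> v) \<oplus>\<^bsub>?V\<^esub> (a \<odot>\<^bsub>?V\<^esub> w)"
    by (auto dest!: supp_mat_carrier intro: add_smult_distrib_left_mat)
qed (auto simp: add_supp_mat smult_supp_mat class_field add_smult_distrib_right_mat dest: supp_mat_carrier)

lemma subspace_supp_mat:
  assumes "r \<subseteq> s"
  shows "VectorSpace.subspace class_ring (supp_mat n r)
    ((skew_matrix_algebra n c)\<lparr>carrier := supp_mat n s\<rparr>)"
proof (rule subspace.intro)
  show "submodule class_ring (supp_mat n r) ((skew_matrix_algebra n c)\<lparr>carrier := supp_mat n s\<rparr>)"
    using supp_mat_mono[OF assms, of n]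
    by (intro submodule.intro vectorspace.axioms(1)[OF vectorspace_supp_mat])
      (simp_all add: add_supp_mat smult_supp_mat)
qed (rule vectorspace_supp_mat)

lemma carrier_update_carrier [simp]:
  "(skew_matrix_algebra n c)\<lparr>carrier := carrier_mat n n\<rparr> = skew_matrix_algebra n c"
  by (simp add: skew_matrix_algebra_def)

lemma vectorspace_skew: "vectorspace class_ring (skew_matrix_algebra n c)"
  using vectorspace_supp_mat[where r = UNIV] by (simp add: supp_mat_UNIV)

lemma subspace_skew: "VectorSpace.subspace class_ring (supp_mat n r) (skew_matrix_algebra n c)"
  using subspace_supp_mat[of r UNIV] by (simp add: supp_mat_UNIV)

text \<open>Translates the spans in the theorem into support conditions: \<open>supp_mat n r\<close>
  is a subspace containing the units, and \<open>supp_mat_induct\<close> builds each of its elements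
  from them.\<close>

lemma span_mat_units:
  assumes r: "r \<subseteq> {..<n} \<times> {..<n}"
  shows "lin_span (skew_matrix_algebra n c) {mat_unit n i j | i j. (i, j) \<in> r} = supp_mat n r"
    (is "lin_span ?A ?E = _")
proof -
  interpret vectorspace class_ring ?A by (rule vectorspace_skew)
  have sub: "?E \<subseteq> carrier ?A" by auto
  have E: "?E \<subseteq> supp_mat n r" by (auto intro: mat_unit_supp_mat)
  have "span ?E \<subseteq> supp_mat n r"
    using span_is_subset[OF E] subspace_skew by (auto simp: subspace_def)
  moreover have "X \<in> span ?E" if X: "X \<in> supp_mat n r" for X
  proof -
    interpret span: submodule class_ring "span ?E" ?A
      by (rule span_is_submodule[OF sub])
    show ?thesis using X
    proof (induction rule: supp_mat_induct)
      case zero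
      then show ?case using span.zero_closed by simp
    next
      case (add i j a Y)
      have "mat_unit n i j \<in> ?E" using add.hyps by blast
      then have "mat_unit n i j \<in> span ?E"
        using in_own_span[OF sub] by blast
      then show ?case
        using span.m_closed[OF span.smult_closed[of a] add.IH] by simp
    qed
  qed
  ultimately show ?thesis by blast
qed

section \<open>Products, associators and the nucleus\<close>

lemma skew_mult_carrier [simp]: "skew_mult n c X Y \<in> carrier_mat n n"
  by (simp add: skew_mult_def)

lemma skew_mult_index [simp]:
  "i < n \<Longrightarrow> l < n \<Longrightarrow> skew_mult n c X Y $$ (i, l) = (\<Sum>j<n. c i j l * (X $$ (i, j) * Y $$ (j, l)))"
  by (simp add: skew_mult_def)

lemma skew_mult_nonzeroE:
  assumes "skew_mult n c X Y $$ (i, l) \<noteq> 0" "i < n" "l < n"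
  obtains j where "j < n" "c i j l \<noteq> 0" "X $$ (i, j) \<noteq> 0" "Y $$ (j, l) \<noteq> 0"
proof -
  have "(\<Sum>j<n. c i j l * (X $$ (i, j) * Y $$ (j, l))) \<noteq> 0" using assms by simp
  then obtain j where "j < n" "c i j l * (X $$ (i, j) * Y $$ (j, l)) \<noteq> 0"
    by (metis (no_types, lifting) lessThan_iff sum.neutral)
  then show ?thesis using that by auto
qed

text \<open>Entry \<open>(i, l)\<close> of the associator is a sum over paths from \<open>i\<close>
  via \<open>j\<close> and \<open>k\<close> to \<open>l\<close>, each weighted by the defect of the
  cocycle identity at these four indices.\<close>

lemma associator_eq_zero_iff:
  fixes X Y Z :: "'a :: field mat"
  shows "X \<in> carrier_mat n n \<Longrightarrow> Y \<in> carrier_mat n n \<Longrightarrow> Z \<in> carrier_mat n n \<Longrightarrow>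
   associator (skew_matrix_algebra n c) X Y Z = 0\<^sub>m n n \<longleftrightarrow>
   (\<forall>i<n. \<forall>l<n. (\<Sum>j<n. \<Sum>k<n. (c i j k * c i k l - c i j l * c j k l) *
      (X $$ (i, j) * Y $$ (j, k) * Z $$ (k, l))) = 0)"
proof -
  let ?A = "skew_matrix_algebra n c"
  interpret vectorspace class_ring ?A by (rule vectorspace_skew)
  assume "X \<in> carrier_mat n n" "Y \<in> carrier_mat n n" "Z \<in> carrier_mat n n"
  have "associator ?A X Y Z = 0\<^sub>m n n \<longleftrightarrow>
    skew_mult n c (skew_mult n c X Y) Z = skew_mult n c X (skew_mult n c Y Z)"
    using minus_other_side by (simp add: associator_def)
  also have "\<dots> \<longleftrightarrow> (\<forall>i<n. \<forall>l<n.
      (\<Sum>k<n. c i k l * ((\<Sum>j<n. c i j k * (X $$ (i, j) * Y $$ (j, k))) * Z $$ (k, l)))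
    = (\<Sum>j<n. c i j l * (X $$ (i, j) * (\<Sum>k<n. c j k l * (Y $$ (j, k) * Z $$ (k, l))))))"
    by (auto simp: skew_mult_def mat_eq_iff)
  also have "\<dots> \<longleftrightarrow> (\<forall>i<n. \<forall>l<n. (\<Sum>j<n. \<Sum>k<n. (c i j k * c i k l - c i j l * c j k l) *
      (X $$ (i, j) * Y $$ (j, k) * Z $$ (k, l))) = 0)"
  proof -
    have "(\<Sum>k<n. c i k l * ((\<Sum>j<n. c i j k * (X $$ (i, j) * Y $$ (j, k))) * Z $$ (k, l)))
      = (\<Sum>j<n. \<Sum>k<n. c i j k * c i k l * (X $$ (i, j) * Y $$ (j, k) * Z $$ (k, l)))" for i l
      by (subst sum.swap) (simp add: sum_distrib_left sum_distrib_right mult_ac)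
    moreover have "(\<Sum>j<n. c i j l * (X $$ (i, j) * (\<Sum>k<n. c j k l * (Y $$ (j, k) * Z $$ (k, l)))))
      = (\<Sum>j<n. \<Sum>k<n. c i j l * c j k l * (X $$ (i, j) * Y $$ (j, k) * Z $$ (k, l)))" for i l
      by (simp add: sum_distrib_left mult_ac)
    ultimately show ?thesis
      by (simp add: left_diff_distrib sum_subtractf)
  qed
  finally show ?thesis .
qed

lemma associatorD:
  fixes X Y Z :: "'a :: field mat"
  shows "associator (skew_matrix_algebra n c) X Y Z = 0\<^sub>m n n \<Longrightarrow>
   X \<in> carrier_mat n n \<Longrightarrow> Y \<in> carrier_mat n n \<Longrightarrow> Z \<in> carrier_mat n n \<Longrightarrow> i < n \<Longrightarrow> l < n \<Longrightarrow>
   (\<Sum>j<n. \<Sum>k<n. (c i j k * c i k l - c i j l * c j k l) *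
      (X $$ (i, j) * Y $$ (j, k) * Z $$ (k, l))) = 0"
  by (simp add: associator_eq_zero_iff)

text \<open>The three identities say that the associator of composable matrix units vanishes when
  the unit at \<open>(i, j)\<close> stands in first, second or third place.\<close>

definition nuc :: "nat \<Rightarrow> (nat \<Rightarrow> nat \<Rightarrow> nat \<Rightarrow> 'a :: field) \<Rightarrow> (nat \<times> nat) set" where
  "nuc n c = {(i, j). i < n \<and> j < n \<and> (\<forall>k<n. \<forall>l<n.
     c i j k * c i k l = c i j l * c j k l \<and>
     c k i j * c k j l = c k i l * c i j l \<and>
     c k l i * c k i j = c k l j * c l i j)}"

lemma sum_if_lessThan: "a < n \<Longrightarrow> (\<Sum>j<(n::nat). if j = a then f j else 0) = (f a :: 'b :: comm_monoid_add)"
  by simp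

lemma nucleus_skew:
  fixes c :: "nat \<Rightarrow> nat \<Rightarrow> nat \<Rightarrow> 'a :: field"
  shows "nucleus (skew_matrix_algebra n c) = supp_mat n (nuc n c)"
proof (intro equalityI subsetI)
  fix X assume X: "X \<in> nucleus (skew_matrix_algebra n c)"
  then have Xc: "X \<in> carrier_mat n n" by (simp add: nucleus_def)
  show "X \<in> supp_mat n (nuc n c)"
  proof (rule supp_matI[OF Xc])
    fix i j assume ij: "i < n" "j < n" and nz: "X $$ (i, j) \<noteq> 0"
    have "c i j k * c i k l = c i j l * c j k l" if "k < n" "l < n" for k l
    proof -
      \<comment> \<open>Probing with the units that continue the path from \<open>j\<close> to
        \<open>k\<close> to \<open>l\<close> leaves one term in entry \<open>(i, l)\<close>: the
        cocycle defect times the nonzero \<open>X $$ (i, j)\<close>. The other two places are probed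
        in the same way.\<close>
      let ?Y = "mat_unit n j k" and ?Z = "mat_unit n k l"
      have "associator (skew_matrix_algebra n c) X ?Y ?Z = 0\<^sub>m n n"
        using X by (auto simp: nucleus_def)
      then have "0 = (\<Sum>j'<n. \<Sum>k'<n. (c i j' k' * c i k' l - c i j' l * c j' k' l) *
        (X $$ (i, j') * ?Y $$ (j', k') * ?Z $$ (k', l)))"
        using that ij Xc by (intro associatorD[symmetric]) auto
      also have "\<dots> = (\<Sum>j'<n. \<Sum>k'<n. if k' = k then if j' = j then
          (c i j k * c i k l - c i j l * c j k l) * X $$ (i, j) else 0 else 0)"
        using that ij by (intro sum.cong) auto
      also have "\<dots> = (c i j k * c i k l - c i j l * c j k l) * X $$ (i, j)"
        using that ij by (simp add: sum_if_lessThan)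
      finally show ?thesis using nz by simp
    qed
    moreover have "c h i j * c h j l = c h i l * c i j l" if "h < n" "l < n" for h l
    proof -
      let ?Y = "mat_unit n h i" and ?Z = "mat_unit n j l"
      have "associator (skew_matrix_algebra n c) ?Y X ?Z = 0\<^sub>m n n"
        using X by (auto simp: nucleus_def)
      then have "0 = (\<Sum>j'<n. \<Sum>k'<n. (c h j' k' * c h k' l - c h j' l * c j' k' l) *
        (?Y $$ (h, j') * X $$ (j', k') * ?Z $$ (k', l)))"
        using that ij Xc by (intro associatorD[symmetric]) auto
      also have "\<dots> = (\<Sum>j'<n. \<Sum>k'<n. if k' = j then if j' = i then
          (c h i j * c h j l - c h i l * c i j l) * X $$ (i, j) else 0 else 0)"
        using that ij by (intro sum.cong) auto
      also have "\<dots> = (c h i j * c h j l - c h i l * c i j l) * X $$ (i, j)"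
        using that ij by (simp add: sum_if_lessThan)
      finally show ?thesis using nz by simp
    qed
    moreover have "c h k i * c h i j = c h k j * c k i j" if "h < n" "k < n" for h k
    proof -
      let ?Y = "mat_unit n h k" and ?Z = "mat_unit n k i"
      have "associator (skew_matrix_algebra n c) ?Y ?Z X = 0\<^sub>m n n"
        using X by (auto simp: nucleus_def)
      then have "0 = (\<Sum>j'<n. \<Sum>k'<n. (c h j' k' * c h k' j - c h j' j * c j' k' j) *
        (?Y $$ (h, j') * ?Z $$ (j', k') * X $$ (k', j)))"
        using that ij Xc by (intro associatorD[symmetric]) auto
      also have "\<dots> = (\<Sum>j'<n. \<Sum>k'<n. if k' = i then if j' = k then
          (c h k i * c h i j - c h k j * c k i j) * X $$ (i, j) else 0 else 0)"
        using that ij by (intro sum.cong) auto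
      also have "\<dots> = (c h k i * c h i j - c h k j * c k i j) * X $$ (i, j)"
        using that ij by (simp add: sum_if_lessThan)
      finally show ?thesis using nz by simp
    qed
    ultimately show "(i, j) \<in> nuc n c" using ij unfolding nuc_def by blast
  qed
next
  fix X :: "'a mat" assume X: "X \<in> supp_mat n (nuc n c)"
  have Xc: "X \<in> carrier_mat n n" by (rule supp_mat_carrier[OF X])
  have nz: "X $$ (i, j) = 0 \<or> (i, j) \<in> nuc n c" if "i < n" "j < n" for i j
    using supp_matD[OF X that] by blast
  \<comment> \<open>Every summand contains an entry of \<open>X\<close>: either this entry is zero,
    or its position lies in \<open>nuc n c\<close> and the cocycle defect vanishes.\<close>
  have "associator (skew_matrix_algebra n c) X Y Z = 0\<^sub>m n n \<and>
        associator (skew_matrix_algebra n c) Y X Z = 0\<^sub>m n n \<and>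
        associator (skew_matrix_algebra n c) Y Z X = 0\<^sub>m n n"
    if YZ: "Y \<in> carrier_mat n n" "Z \<in> carrier_mat n n" for Y Z :: "'a mat"
    unfolding associator_eq_zero_iff[OF Xc YZ] associator_eq_zero_iff[OF YZ(1) Xc YZ(2)]
      associator_eq_zero_iff[OF YZ Xc]
    apply (intro conjI allI impI sum.neutral ballI)
    subgoal for i l j k using nz[of i j] by (auto simp: nuc_def)
    subgoal for i l j k using nz[of j k] by (auto simp: nuc_def)
    subgoal for i l j k using nz[of k l] by (auto simp: nuc_def)
    done
  then show "X \<in> nucleus (skew_matrix_algebra n c)"
    using Xc by (auto simp: nucleus_def)
qed

lemma mat_unit_in_nucleus:
  "i < n \<Longrightarrow> j < n \<Longrightarrow>
    mat_unit n i j \<in> nucleus (skew_matrix_algebra n c) \<longleftrightarrow> (i, j) \<in> nuc n c"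
  unfolding nucleus_skew by (auto intro: mat_unit_supp_mat dest: supp_matD[where i = i and j = j])

lemma skew_mult_smult_left:
  "X \<in> carrier_mat n n \<Longrightarrow> Y \<in> carrier_mat n n \<Longrightarrow>
    skew_mult n c (a \<cdot>\<^sub>m X) Y = a \<cdot>\<^sub>m skew_mult n c X Y"
  by (intro eq_matI) (auto simp: skew_mult_def sum_distrib_left mult_ac)

lemma skew_mult_add_right:
  "X \<in> carrier_mat n n \<Longrightarrow> Y \<in> carrier_mat n n \<Longrightarrow> Z \<in> carrier_mat n n \<Longrightarrow>
    skew_mult n c X (Y + Z) = skew_mult n c X Y + skew_mult n c X Z"
  by (intro eq_matI) (auto simp: skew_mult_def ring_distribs sum.distrib)

lemma mat_unit_skew_mult_index:
  assumes "p < n" "q < n" "i < n" "k < n"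
  shows "skew_mult n c (mat_unit n i k) Y $$ (p, q) = (if p = i then c i k q * Y $$ (k, q) else 0)"
proof -
  have "skew_mult n c (mat_unit n i k) Y $$ (p, q) =
      (\<Sum>j<n. if j = k then if p = i then c i k q * Y $$ (k, q) else 0 else 0)"
    unfolding skew_mult_index[OF assms(1,2)] using assms by (intro sum.cong) auto
  then show ?thesis using assms by (simp add: sum_if_lessThan)
qed

section \<open>Cocycle identities and composition of nuclear positions\<close>

lemma nuc_less: "(i, j) \<in> nuc n c \<Longrightarrow> i < n \<and> j < n"
  by (auto simp: nuc_def)

lemma nuc_subset: "nuc n c \<subseteq> {..<n} \<times> {..<n}"
  by (auto simp: nuc_def)

lemma nuc_cocycle:
  assumes "(i, j) \<in> nuc n c" "k < n" "l < n"
  shows "c i j k * c i k l = c i j l * c j k l"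
    "c k i j * c k j l = c k i l * c i j l"
    "c k l i * c k i j = c k l j * c l i j"
  using assms unfolding nuc_def by blast+

lemma nucI:
  assumes "i < n" "j < n"
    and "\<And>k l. k < n \<Longrightarrow> l < n \<Longrightarrow> c i j k * c i k l = c i j l * c j k l"
    and "\<And>k l. k < n \<Longrightarrow> l < n \<Longrightarrow> c k i j * c k j l = c k i l * c i j l"
    and "\<And>k l. k < n \<Longrightarrow> l < n \<Longrightarrow> c k l i * c k i j = c k l j * c l i j"
  shows "(i, j) \<in> nuc n c"
  using assms unfolding nuc_def by blast

text \<open>The algebra behind \<open>nuc_trans\<close>, where \<open>a\<close> is the coefficient
  of a product of two nuclear units: the goal is multiplied by \<open>a\<close>, the four identities
  are applied in turn, and \<open>a\<close> is cancelled.\<close>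

lemma mult_cancel_chain:
  fixes a :: "'a :: field"
  assumes "a \<noteq> 0" "a * b = p * d" "p * e = f * g" "d * g = h * k" "a * l = f * h"
  shows "b * e = l * k"
proof -
  have "a * (b * e) = (p * e) * d" using assms(2) by (metis mult.assoc mult.commute)
  also have "\<dots> = f * (d * g)" unfolding assms(3) by (simp only: mult_ac)
  also have "\<dots> = (f * h) * k" unfolding assms(4) by (simp only: mult_ac)
  also have "\<dots> = a * (l * k)" unfolding assms(5)[symmetric] by (simp only: mult_ac)
  finally show ?thesis using assms(1) by simp
qed

text \<open>The algebra behind \<open>nuc_eq_sym\<close>: since \<open>y = t / x\<close> and
  \<open>w = t / z\<close>, an identity with coefficients \<open>x\<close> and \<open>z\<close>
  turns into one with coefficients \<open>y\<close> and \<open>w\<close>.\<close>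

lemma mult_cancel_cross:
  fixes x :: "'a :: field"
  assumes "x \<noteq> 0" "z \<noteq> 0" "x * y = t" "z * w = t" "x * u = z * v"
  shows "y * v = w * u"
proof -
  have "(x * z) * (y * v) = (x * y) * (z * v)" by (simp only: mult_ac)
  also have "\<dots> = (z * w) * (x * u)" unfolding assms(3-5) ..
  also have "\<dots> = (x * z) * (w * u)" by (simp only: mult_ac)
  finally show ?thesis using assms(1,2) by simp
qed

text \<open>The nucleus is closed under products, and by \<open>nz\<close> the unit at
  \<open>(i, l)\<close> is a nonzero multiple of the product of the units at \<open>(i, j)\<close>
  and \<open>(j, l)\<close>. The proof carries this out on the cocycle identities, cancelling
  \<open>c i j l\<close>.\<close>

lemma nuc_trans:
  assumes ij: "(i, j) \<in> nuc n c" and jl: "(j, l) \<in> nuc n c" and nz: "c i j l \<noteq> 0"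
  shows "(i, l) \<in> nuc n c"
proof (rule nucI)
  show less: "i < n" "l < n" using ij jl nuc_less by blast+
  have j: "j < n" using ij nuc_less by blast
  fix k m assume km: "k < n" "m < n"
  show "c i l k * c i k m = c i l m * c l k m"
    by (rule mult_cancel_chain[OF nz nuc_cocycle(1)[OF ij less(2) km(1)]
          nuc_cocycle(1)[OF ij km] nuc_cocycle(1)[OF jl km] nuc_cocycle(1)[OF ij less(2) km(2)]])
  \<comment> \<open>Second place, and below it third place: the identities for \<open>(i, j)\<close>
    and \<open>(j, l)\<close> with factors reordered to fit
    \<open>mult_cancel_chain\<close>.\<close>
  have "c i j l * c k i l = c k j l * c k i j"
    using nuc_cocycle(2)[OF ij km(1) less(2)] by (metis mult.commute)
  moreover have "c k j l * c k l m = c j l m * c k j m"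
    using nuc_cocycle(2)[OF jl km] by (metis mult.commute)
  moreover have "c k i j * c k j m = c i j m * c k i m"
    using nuc_cocycle(2)[OF ij km] by (metis mult.commute)
  moreover have "c i j l * c i l m = c j l m * c i j m"
    using nuc_cocycle(1)[OF ij less(2) km(2)] by (metis mult.commute)
  ultimately have "c k i l * c k l m = c i l m * c k i m"
    by (rule mult_cancel_chain[OF nz])
  then show "c k i l * c k l m = c k i m * c i l m" by (metis mult.commute)
  have "c i j l * c k i l = c k i j * c k j l"
    using nuc_cocycle(2)[OF ij km(1) less(2)] by (metis mult.commute)
  moreover have "c k i j * c k m i = c m i j * c k m j"
    using nuc_cocycle(3)[OF ij km] by (metis mult.commute)
  moreover have "c k j l * c k m j = c m j l * c k m l"
    using nuc_cocycle(3)[OF jl km] by (metis mult.commute)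
  moreover have "c i j l * c m i l = c m i j * c m j l"
    using nuc_cocycle(2)[OF ij km(2) less(2)] by (metis mult.commute)
  ultimately have "c k i l * c k m i = c m i l * c k m l"
    by (rule mult_cancel_chain[OF nz])
  then show "c k m i * c k i l = c k m l * c m i l" by (metis mult.commute)
qed

section \<open>The equivalence relation on the indices and its complement among the nuclear
  positions\<close>

definition nuc_eq :: "nat \<Rightarrow> (nat \<Rightarrow> nat \<Rightarrow> nat \<Rightarrow> 'a :: field) \<Rightarrow> (nat \<times> nat) set" where
  "nuc_eq n c = {(i, j) \<in> nuc n c. c i j i \<noteq> 0}"

text \<open>This is the support of the Jacobson radical, see
  \<open>jacobson_radical_nucleus\<close>.\<close>

definition nuc_rad :: "nat \<Rightarrow> (nat \<Rightarrow> nat \<Rightarrow> nat \<Rightarrow> 'a :: field) \<Rightarrow> (nat \<times> nat) set" where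
  "nuc_rad n c = nuc n c - nuc_eq n c"

lemma nuc_eq_subset: "nuc_eq n c \<subseteq> nuc n c"
  by (auto simp: nuc_eq_def)

lemma nuc_rad_subset: "nuc_rad n c \<subseteq> nuc n c"
  by (auto simp: nuc_rad_def)

locale reduced_skew =
  fixes n :: nat and c :: "nat \<Rightarrow> nat \<Rightarrow> nat \<Rightarrow> 'a :: field"
  assumes reduced: "reduced_skew_set n c"
begin

abbreviation "N \<equiv> nucleus_algebra (skew_matrix_algebra n c)"

lemma reducedD [simp]: "i < n \<Longrightarrow> j < n \<Longrightarrow> c i i j = 1" "i < n \<Longrightarrow> j < n \<Longrightarrow> c i j j = 1"
  using reduced by (auto simp: reduced_skew_set_def)

lemma nuc_eq_refl: "i < n \<Longrightarrow> (i, i) \<in> nuc_eq n c"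
  by (auto simp: nuc_eq_def intro!: nucI)

text \<open>For a reduced \<open>c\<close> the cocycle identity gives
  \<open>c i j m * c j i m = c i j i\<close> for every \<open>m\<close>, so both factors on the left
  are nonzero. The coefficients ending in \<open>i\<close> or \<open>j\<close> follow from
  \<open>c l j i * c l i j = c j i j\<close>.\<close>

lemma nuc_eq_nonzero:
  assumes ij: "(i, j) \<in> nuc_eq n c" and l: "l < n"
  shows "c i j l \<noteq> 0" "c l i j \<noteq> 0" "c j i l \<noteq> 0" "c l j i \<noteq> 0"
proof -
  have N: "(i, j) \<in> nuc n c" and nz: "c i j i \<noteq> 0" and less: "i < n" "j < n"
    using ij nuc_less by (auto simp: nuc_eq_def)
  have 1: "c i j m \<noteq> 0 \<and> c j i m \<noteq> 0" if "m < n" for m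
    using nuc_cocycle(1)[OF N less(1) that] nz that less by auto
  then show "c i j l \<noteq> 0" "c j i l \<noteq> 0" using l by auto
  have "c l j i * c l i j = c l j j * c j i j"
    using nuc_cocycle(3)[OF N l less(2)] .
  then show "c l i j \<noteq> 0" "c l j i \<noteq> 0" using 1[OF less(2)] l less by auto
qed

text \<open>The units at \<open>(i, j)\<close> and \<open>(j, i)\<close> are inverse to each other
  up to the scalar \<open>t = c i j i\<close>: both \<open>c i j k * c j i k\<close> and
  \<open>c k i j * c k j i\<close> equal \<open>t\<close> for all \<open>k\<close>. Dividing
  \<open>t\<close> by the coefficients in the identities of \<open>(i, j)\<close> yields those of
  \<open>(j, i)\<close>.\<close>

lemma nuc_eq_sym:
  assumes ij: "(i, j) \<in> nuc_eq n c"
  shows "(j, i) \<in> nuc_eq n c"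
proof -
  have N: "(i, j) \<in> nuc n c" and less: "i < n" "j < n"
    using ij nuc_less by (auto simp: nuc_eq_def)
  define t where "t = c i j i"
  have t: "c i j k * c j i k = t" if "k < n" for k
    using nuc_cocycle(1)[OF N less(1) that] reducedD(1)[OF less(1) that]
    by (metis mult.right_neutral t_def)
  have t': "c k i j * c k j i = t" if "k < n" for k
    using nuc_cocycle(3)[OF N that less(2)] t[OF less(2)] reducedD[OF that less(2)]
      reducedD(2)[OF less]
    by (metis mult.commute mult.left_neutral)
  have "(j, i) \<in> nuc n c"
  proof (rule nucI)
    fix k l assume kl: "k < n" "l < n"
    show "c j i k * c j k l = c j i l * c i k l"
      by (rule mult_cancel_cross[OF nuc_eq_nonzero(1)[OF ij kl(1)] nuc_eq_nonzero(1)[OF ij kl(2)]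
            t[OF kl(1)] t[OF kl(2)] nuc_cocycle(1)[OF N kl]])
    have "c k i j * c k j l = c i j l * c k i l"
      using nuc_cocycle(2)[OF N kl] by (metis mult.commute)
    then have "c k j i * c k i l = c j i l * c k j l"
      by (rule mult_cancel_cross[OF nuc_eq_nonzero(2)[OF ij kl(1)] nuc_eq_nonzero(1)[OF ij kl(2)]
            t'[OF kl(1)] t[OF kl(2)]])
    then show "c k j i * c k i l = c k j l * c j i l" by (metis mult.commute)
    have "c k i j * c k l i = c l i j * c k l j"
      using nuc_cocycle(3)[OF N kl] by (metis mult.commute)
    then have "c k j i * c k l j = c l j i * c k l i"
      by (rule mult_cancel_cross[OF nuc_eq_nonzero(2)[OF ij kl(1)] nuc_eq_nonzero(2)[OF ij kl(2)]
            t'[OF kl(1)] t'[OF kl(2)]])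
    then show "c k l j * c k j i = c k l i * c l j i" by (metis mult.commute)
  qed (use less in auto)
  then show ?thesis using nuc_eq_nonzero(3)[OF ij less(2)] by (simp add: nuc_eq_def)
qed

text \<open>Nuclearity is \<open>nuc_trans\<close>, and \<open>c i l i\<close> is nonzero because
  the right side of \<open>c i j l * c i l i = c i j i * c j l i\<close> is.\<close>

lemma nuc_eq_trans:
  assumes ij: "(i, j) \<in> nuc_eq n c" and jl: "(j, l) \<in> nuc_eq n c"
  shows "(i, l) \<in> nuc_eq n c"
proof -
  have N: "(i, j) \<in> nuc n c" "(j, l) \<in> nuc n c" and less: "i < n" "j < n" "l < n"
    using ij jl nuc_less by (auto simp: nuc_eq_def)
  have "(i, l) \<in> nuc n c" by (rule nuc_trans[OF N nuc_eq_nonzero(1)[OF ij less(3)]])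
  moreover have "c i l i \<noteq> 0"
    using nuc_cocycle(1)[OF N(1) less(3,1)] nuc_eq_nonzero(1)[OF ij less(1)]
      nuc_eq_nonzero(1)[OF jl less(1)] by auto
  ultimately show ?thesis by (simp add: nuc_eq_def)
qed

lemma equiv_nuc_eq: "equiv {..<n} (nuc_eq n c)"
proof (rule equivI)
  show "nuc_eq n c \<subseteq> {..<n} \<times> {..<n}"
    using nuc_eq_subset nuc_subset by (rule order_trans)
  show "refl_on {..<n} (nuc_eq n c)" by (rule refl_onI) (simp add: nuc_eq_refl)
  show "sym (nuc_eq n c)" by (rule symI) (rule nuc_eq_sym)
  show "trans (nuc_eq n c)" by (rule transI) (rule nuc_eq_trans)
qed

text \<open>In \<open>c k l j * c k j k = c k l k * c l j k\<close> the left side is nonzero, hence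
  so is \<open>c k l k\<close>; the second factor then follows by symmetry and transitivity. This is
  what makes the unrelated positions absorb products.\<close>

lemma nuc_eq_factors:
  assumes kl: "(k, l) \<in> nuc n c" and lj: "(l, j) \<in> nuc n c" and kj: "(k, j) \<in> nuc_eq n c"
    and nz: "c k l j \<noteq> 0"
  shows "(k, l) \<in> nuc_eq n c" "(l, j) \<in> nuc_eq n c"
proof -
  have less: "k < n" "l < n" "j < n" using kl lj nuc_less by blast+
  have "c k l j * c k j k = c k l k * c l j k"
    using nuc_cocycle(1)[OF kl less(3,1)] .
  moreover have "c k j k \<noteq> 0" using nuc_eq_nonzero(1)[OF kj less(1)] .
  ultimately have "c k l k \<noteq> 0" using nz by auto
  then show 1: "(k, l) \<in> nuc_eq n c" using kl by (simp add: nuc_eq_def)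
  show "(l, j) \<in> nuc_eq n c" using nuc_eq_trans[OF nuc_eq_sym[OF 1] kj] .
qed

lemma nuc_rad_left:
  "(k, l) \<in> nuc n c \<Longrightarrow> (l, j) \<in> nuc_rad n c \<Longrightarrow> c k l j \<noteq> 0 \<Longrightarrow> (k, j) \<in> nuc_rad n c"
  using nuc_eq_factors(2) nuc_trans by (auto simp: nuc_rad_def)

end

section \<open>Left ideals of the nucleus and its Jacobson radical\<close>

context reduced_skew
begin

lemma carrier_N: "carrier N = supp_mat n (nuc n c)"
  by (simp add: nucleus_skew)

lemma vectorspace_N: "vectorspace class_ring N"
  using vectorspace_supp_mat[where n = n and c = c and r = "nuc n c"] by (simp add: nucleus_skew)

lemma scalar_supp_mat: "a \<cdot>\<^sub>m 1\<^sub>m n \<in> supp_mat n (nuc_eq n c)"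
  using nuc_eq_refl by (auto intro!: supp_matI simp: one_mat_def split: if_splits)

lemma scalar_skew_mult: "X \<in> carrier_mat n n \<Longrightarrow> skew_mult n c (a \<cdot>\<^sub>m 1\<^sub>m n) X = a \<cdot>\<^sub>m X"
  by (simp add: skew_mult_smult_left skew_mult_one[OF reduced])

text \<open>Closure under negation comes from left multiplication by \<open>-1\<close> times the
  identity, which lies in the nucleus.\<close>

lemma left_idealI:
  assumes sub: "I \<subseteq> supp_mat n (nuc n c)" and zero: "0\<^sub>m n n \<in> I"
    and add: "\<And>X Y. X \<in> I \<Longrightarrow> Y \<in> I \<Longrightarrow> X + Y \<in> I"
    and mult: "\<And>R X. R \<in> supp_mat n (nuc n c) \<Longrightarrow> X \<in> I \<Longrightarrow> skew_mult n c R X \<in> I"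
  shows "left_ideal I N"
proof -
  interpret vectorspace class_ring N by (rule vectorspace_N)
  have inv: "\<ominus>\<^bsub>N\<^esub> X \<in> I" if X: "X \<in> I" for X
  proof -
    have Xc: "X \<in> carrier_mat n n" using X sub supp_mat_carrier by blast
    have sc: "(- 1) \<cdot>\<^sub>m 1\<^sub>m n \<in> supp_mat n (nuc n c)"
      using scalar_supp_mat supp_mat_mono[OF nuc_eq_subset] by blast
    have m: "skew_mult n c ((- 1) \<cdot>\<^sub>m 1\<^sub>m n) X \<in> I"
      using mult[OF sc X] .
    moreover have "skew_mult n c ((- 1) \<cdot>\<^sub>m 1\<^sub>m n) X \<oplus>\<^bsub>N\<^esub> X = \<zero>\<^bsub>N\<^esub>"
      using Xc by (intro eq_matI) (auto simp: scalar_skew_mult)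
    ultimately have "\<ominus>\<^bsub>N\<^esub> X = skew_mult n c ((- 1) \<cdot>\<^sub>m 1\<^sub>m n) X"
      using X sub by (intro minus_equality) (auto simp: carrier_N)
    then show ?thesis using m by simp
  qed
  have "additive_subgroup I N"
  proof (intro additive_subgroup.intro subgroup.intro)
    show "inv\<^bsub>add_monoid N\<^esub> X \<in> I" if "X \<in> I" for X
      using inv[OF that] by (simp only: a_inv_def)
  qed (use sub zero add in \<open>auto simp: nucleus_skew\<close>)
  then show ?thesis
    using mult by (auto simp: left_ideal_def carrier_N)
qed

lemma left_idealD:
  assumes "left_ideal I N"
  shows "I \<subseteq> supp_mat n (nuc n c)" "0\<^sub>m n n \<in> I"
    "X \<in> I \<Longrightarrow> Y \<in> I \<Longrightarrow> X + Y \<in> I"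
    "R \<in> supp_mat n (nuc n c) \<Longrightarrow> X \<in> I \<Longrightarrow> skew_mult n c R X \<in> I"
proof -
  have "additive_subgroup I N" using assms by (simp add: left_ideal_def)
  then interpret additive_subgroup I N .
  show "I \<subseteq> supp_mat n (nuc n c)" using a_subset unfolding carrier_N .
  show "0\<^sub>m n n \<in> I" using zero_closed by simp
  show "X \<in> I \<Longrightarrow> Y \<in> I \<Longrightarrow> X + Y \<in> I" using a_closed by simp
  show "R \<in> supp_mat n (nuc n c) \<Longrightarrow> X \<in> I \<Longrightarrow> skew_mult n c R X \<in> I"
    using assms by (simp add: left_ideal_def nucleus_skew)
qed

text \<open>\<open>left_ideal\<close> mentions ring operations only, but scaling by \<open>a\<close>
  is left multiplication by the nuclear element \<open>a\<close> times the identity.\<close>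

lemma left_ideal_smult:
  assumes I: "left_ideal I N" and X: "X \<in> I"
  shows "a \<cdot>\<^sub>m X \<in> I"
proof -
  have "a \<cdot>\<^sub>m 1\<^sub>m n \<in> supp_mat n (nuc n c)"
    using scalar_supp_mat supp_mat_mono[OF nuc_eq_subset] by blast
  from left_idealD(4)[OF I this X] show ?thesis
    using left_idealD(1)[OF I] X supp_mat_carrier by (metis scalar_skew_mult subsetD)
qed

text \<open>A nonzero entry of a product needs an intermediate index \<open>j\<close> at which both
  factors and the coefficient are nonzero. Closure questions thus reduce to composing relations
  where \<open>c\<close> does not vanish.\<close>

lemma skew_mult_supp_mat:
  assumes "X \<in> supp_mat n r" "Y \<in> supp_mat n s"
    and comp: "\<And>i j k. (i, j) \<in> r \<Longrightarrow> (j, k) \<in> s \<Longrightarrow> c i j k \<noteq> 0 \<Longrightarrow> (i, k) \<in> t"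
  shows "skew_mult n c X Y \<in> supp_mat n t"
proof (rule supp_matI)
  fix i k assume less: "i < n" "k < n" and nz: "skew_mult n c X Y $$ (i, k) \<noteq> 0"
  from skew_mult_nonzeroE[OF nz less] obtain j
    where j: "j < n" "c i j k \<noteq> 0" "X $$ (i, j) \<noteq> 0" "Y $$ (j, k) \<noteq> 0" .
  show "(i, k) \<in> t"
    using comp[of i j k] supp_matD[OF assms(1) less(1) j(1)] supp_matD[OF assms(2) j(1) less(2)] j
    by blast
qed simp

lemma left_ideal_supp_mat:
  assumes "r \<subseteq> nuc n c"
    and "\<And>i j k. (i, j) \<in> nuc n c \<Longrightarrow> (j, k) \<in> r \<Longrightarrow> c i j k \<noteq> 0 \<Longrightarrow> (i, k) \<in> r"
  shows "left_ideal (supp_mat n r) N"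
  using supp_mat_mono[OF assms(1)] assms(2)
  by (intro left_idealI add_supp_mat skew_mult_supp_mat[where r = "nuc n c" and s = r and t = r]) auto

lemma supp_mat_subset_left_ideal:
  assumes I: "left_ideal I N"
    and units: "\<And>i j. i < n \<Longrightarrow> j < n \<Longrightarrow> (i, j) \<in> r \<Longrightarrow> mat_unit n i j \<in> I"
  shows "supp_mat n r \<subseteq> I"
proof
  fix X :: "'a mat" assume "X \<in> supp_mat n r"
  then show "X \<in> I"
    by (induction rule: supp_mat_induct)
      (use left_idealD(2,3)[OF I] left_ideal_smult[OF I] units in auto)
qed

lemma left_ideal_one:
  assumes I: "left_ideal I N" and one: "1\<^sub>m n \<in> I"
  shows "I = supp_mat n (nuc n c)"
proof
  show "supp_mat n (nuc n c) \<subseteq> I"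
  proof
    fix X :: "'a mat" assume X: "X \<in> supp_mat n (nuc n c)"
    from left_idealD(4)[OF I X one] show "X \<in> I"
      using skew_mult_one(2)[OF reduced supp_mat_carrier[OF X]] by simp
  qed
qed (rule left_idealD(1)[OF I])

lemma one_supp_mat: "1\<^sub>m n \<in> supp_mat n (nuc_eq n c)"
  using nuc_eq_refl by (auto intro!: supp_matI simp: one_mat_def split: if_splits)

text \<open>An element of a larger left ideal has a nonzero entry at some \<open>(k, j)\<close> with
  \<open>k\<close> related to \<open>j\<close>. Multiplying by the unit at \<open>(j, k)\<close> and
  rescaling gives an element \<open>W\<close> whose column \<open>j\<close> is that of the identity.
  Then \<open>1 - W\<close> lies in the given ideal, so the larger one contains
  \<open>1\<close>.\<close>

lemma maximal_left_ideal_column: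
  assumes j: "j < n"
  shows "maximal_left_ideal (supp_mat n {p \<in> nuc n c. snd p = j \<longrightarrow> p \<notin> nuc_eq n c}) N"
    (is "maximal_left_ideal (supp_mat n ?r) N")
  unfolding maximal_left_ideal_def
proof (intro conjI allI impI)
  show "left_ideal (supp_mat n ?r) N"
    \<comment> \<open>If a product lands on a related position of column \<open>j\<close>, then by
      \<open>nuc_eq_factors\<close> its right factor already sat on one.\<close>
    by (rule left_ideal_supp_mat) (auto intro: nuc_trans dest: nuc_eq_factors(2))
  have "1\<^sub>m n \<notin> supp_mat n ?r"
    using supp_matD[of "1\<^sub>m n" n ?r j j] j nuc_eq_refl[OF j] by auto
  moreover have "1\<^sub>m n \<in> carrier N"
    using one_supp_mat supp_mat_mono[OF nuc_eq_subset] unfolding carrier_N by blast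
  ultimately show "supp_mat n ?r \<noteq> carrier N" by blast
  fix L assume "left_ideal L N \<and> supp_mat n ?r \<subseteq> L"
  then have L: "left_ideal L N" and sub: "supp_mat n ?r \<subseteq> L" by auto
  show "L = supp_mat n ?r \<or> L = carrier N"
  proof (rule disjCI)
    assume "L \<noteq> carrier N"
    have "Y \<in> supp_mat n ?r" if Y: "Y \<in> L" for Y
    proof (rule ccontr)
      assume "Y \<notin> supp_mat n ?r"
      moreover have Yn: "Y \<in> supp_mat n (nuc n c)" using Y left_idealD(1)[OF L] by blast
      ultimately obtain k where k: "k < n" "(k, j) \<in> nuc_eq n c" "Y $$ (k, j) \<noteq> 0"
        using supp_matD[OF Yn] by (auto simp: supp_mat_def)
      have jk: "(j, k) \<in> nuc_eq n c" using nuc_eq_sym[OF k(2)] .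
      \<comment> \<open>\<open>b\<close> is the entry at \<open>(j, j)\<close> of the product with
        the unit at \<open>(j, k)\<close>; it is nonzero because \<open>j\<close> and
        \<open>k\<close> are related.\<close>
      define b where "b = c j k j * Y $$ (k, j)"
      have b: "b \<noteq> 0" using nuc_eq_nonzero(1)[OF jk j] k by (simp add: b_def)
      define W where "W = inverse b \<cdot>\<^sub>m skew_mult n c (mat_unit n j k) Y"
      have "mat_unit n j k \<in> supp_mat n (nuc n c)"
        using jk nuc_eq_subset by (intro mat_unit_supp_mat) blast
      then have W: "W \<in> L"
        unfolding W_def by (intro left_ideal_smult[OF L] left_idealD(4)[OF L] Y)
      then have Wn: "W \<in> supp_mat n (nuc n c)" using left_idealD(1)[OF L] by blast
      have Wj: "W $$ (p, j) = (if p = j then 1 else 0)" if "p < n" for p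
      proof -
        have "W $$ (p, j) = inverse b * skew_mult n c (mat_unit n j k) Y $$ (p, j)"
          unfolding W_def using that j by (intro index_smult_mat(1)) (simp_all add: skew_mult_def)
        also have "\<dots> = inverse b * (if p = j then b else 0)"
          by (simp only: mat_unit_skew_mult_index[OF that j j k(1)] b_def)
        finally show ?thesis using b by simp
      qed
      have "1\<^sub>m n + (- 1) \<cdot>\<^sub>m W \<in> supp_mat n ?r"
      proof (rule supp_matI)
        show "1\<^sub>m n + (- 1) \<cdot>\<^sub>m W \<in> carrier_mat n n" using supp_mat_carrier[OF Wn] by simp
        fix p q assume pq: "p < n" "q < n" "(1\<^sub>m n + (- 1) \<cdot>\<^sub>m W) $$ (p, q) \<noteq> 0"
        have "1\<^sub>m n \<in> supp_mat n (nuc n c)"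
          using one_supp_mat supp_mat_mono[OF nuc_eq_subset] by blast
        then have "1\<^sub>m n + (- 1) \<cdot>\<^sub>m W \<in> supp_mat n (nuc n c)"
          using Wn by (intro add_supp_mat smult_supp_mat)
        from supp_matD[OF this pq] have "(p, q) \<in> nuc n c" .
        moreover have "q \<noteq> j"
        proof
          assume "q = j"
          then have "(1\<^sub>m n + (- 1) \<cdot>\<^sub>m W) $$ (p, q) = 0"
            using Wj[OF pq(1)] pq(1) j supp_mat_carrier[OF Wn] by simp
          then show False using pq(3) by simp
        qed
        ultimately show "(p, q) \<in> ?r" by simp
      qed
      then have "1\<^sub>m n + (- 1) \<cdot>\<^sub>m W + W \<in> L"
        using sub by (intro left_idealD(3)[OF L _ W]) (rule subsetD)
      moreover have "1\<^sub>m n + (- 1) \<cdot>\<^sub>m W + W = 1\<^sub>m n"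
        using supp_mat_carrier[OF Wn] by (intro eq_matI) auto
      ultimately have "L = carrier N"
        using left_ideal_one[OF L] unfolding carrier_N by simp
      then show False using \<open>L \<noteq> carrier N\<close> by blast
    qed
    then show "L = supp_mat n ?r" using sub by blast
  qed
qed

text \<open>A nonzero entry in column \<open>j\<close> is tested against the maximal left ideal
  belonging to that column.\<close>

lemma jacobson_radical_subset: "jacobson_radical N \<subseteq> supp_mat n (nuc_rad n c)"
proof
  fix X assume X: "X \<in> jacobson_radical N"
  then have Xn: "X \<in> supp_mat n (nuc n c)"
    by (simp add: jacobson_radical_def nucleus_skew)
  show "X \<in> supp_mat n (nuc_rad n c)"
  proof (rule supp_matI[OF supp_mat_carrier[OF Xn]])
    fix i j assume ij: "i < n" "j < n" "X $$ (i, j) \<noteq> 0"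
    have "X \<in> supp_mat n {p \<in> nuc n c. snd p = j \<longrightarrow> p \<notin> nuc_eq n c}"
      using X maximal_left_ideal_column[OF ij(2)] by (simp add: jacobson_radical_def)
    from supp_matD[OF this ij] show "(i, j) \<in> nuc_rad n c" by (simp add: nuc_rad_def)
  qed
qed

lemma left_ideal_rad: "left_ideal (supp_mat n (nuc_rad n c)) N"
  by (rule left_ideal_supp_mat[OF nuc_rad_subset]) (rule nuc_rad_left)

text \<open>With row \<open>i\<close> fixed, \<open>j\<close> is below \<open>l\<close> when right
  multiplication by a radical unit carries the nuclear unit at \<open>(i, l)\<close> to a nonzero
  multiple of the one at \<open>(i, j)\<close>.\<close>

definition rad_step :: "nat \<Rightarrow> (nat \<times> nat) set" where
  "rad_step i = {(j, l). (i, l) \<in> nuc n c \<and> (l, j) \<in> nuc_rad n c \<and> c i l j \<noteq> 0}"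

text \<open>This is the nilpotency of the radical: on finitely many indices the relation is
  transitive, and it is irreflexive because \<open>(l, l)\<close> is never a radical
  position.\<close>

lemma wf_rad_step: "wf (rad_step i)"
proof (rule finite_acyclic_wf)
  have "rad_step i \<subseteq> {..<n} \<times> {..<n}"
    using nuc_less by (fastforce simp: rad_step_def nuc_rad_def)
  then show "finite (rad_step i)" by (rule finite_subset) simp
  have "trans (rad_step i)"
  proof (rule transI)
    fix h j l assume hj: "(h, j) \<in> rad_step i" and jl: "(j, l) \<in> rad_step i"
    have il: "(i, l) \<in> nuc n c" and lj: "(l, j) \<in> nuc_rad n c" and nz1: "c i l j \<noteq> 0"
      and jh: "(j, h) \<in> nuc_rad n c" and nz2: "c i j h \<noteq> 0"
      using hj jl by (auto simp: rad_step_def)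
    have lj': "(l, j) \<in> nuc n c" and jh': "(j, h) \<in> nuc n c"
      using lj jh nuc_rad_subset by blast+
    have less: "j < n" "h < n" using nuc_less[OF jh'] by auto
    \<comment> \<open>The two steps have nonzero coefficients, so both factors on the right are
      nonzero: \<open>c i l h\<close> gives the direct step, and \<open>c l j h\<close> shows that
      the two radical units compose to a radical unit.\<close>
    have "c i l j * c i j h = c i l h * c l j h" by (rule nuc_cocycle(1)[OF il less])
    then have nz: "c i l h \<noteq> 0" "c l j h \<noteq> 0" using nz1 nz2 by (metis mult_eq_0_iff)+
    show "(h, l) \<in> rad_step i"
      using il nz(1) nuc_rad_left[OF lj' jh nz(2)] by (simp add: rad_step_def)
  qed
  then have "(rad_step i)\<^sup>+ = rad_step i" by (rule trancl_id)
  moreover have "(l, l) \<notin> rad_step i" for l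
    using nuc_eq_refl[of l] nuc_less[of i l n c] by (auto simp: rad_step_def nuc_rad_def)
  ultimately show "acyclic (rad_step i)" by (intro acyclicI) simp
qed

text \<open>
  Nakayama's lemma for the radical: multiplying a decomposition \<open>1 = M + T\<close> by \<open>e\<^sub>i\<^sub>l\<close> rewrites
  \<open>e\<^sub>i\<^sub>l\<close> modulo the left ideal into multiples of units \<open>e\<^sub>i\<^sub>j\<close> with \<open>j\<close> below \<open>l\<close> in
  \<^term>\<open>rad_step i\<close>, and this descent ends.
\<close>
lemma left_ideal_plus_rad_one:
  assumes I: "left_ideal I N" and M: "M \<in> I" and T: "T \<in> supp_mat n (nuc_rad n c)"
    and one: "1\<^sub>m n = M + T"
  shows "1\<^sub>m n \<in> I"
proof -
  have units: "(i, l) \<in> nuc n c \<Longrightarrow> mat_unit n i l \<in> I" for i l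
  proof (induction l rule: wf_induct_rule[OF wf_rad_step[of i]])
    case (1 l)
    have less: "i < n" "l < n" using nuc_less[OF 1(2)] by auto
    have Mn: "M \<in> carrier_mat n n" using M left_idealD(1)[OF I] supp_mat_carrier by blast
    have e: "mat_unit n i l \<in> supp_mat n (nuc n c)" using 1(2) by (rule mat_unit_supp_mat)
    have "mat_unit n i l = skew_mult n c (mat_unit n i l) (1\<^sub>m n)"
      by (simp add: skew_mult_one[OF reduced])
    also have "\<dots> = skew_mult n c (mat_unit n i l) M + skew_mult n c (mat_unit n i l) T"
      unfolding one using Mn supp_mat_carrier[OF T] by (simp add: skew_mult_add_right)
    also have "\<dots> \<in> I"
    proof (rule left_idealD(3)[OF I left_idealD(4)[OF I e M]])
      have "skew_mult n c (mat_unit n i l) T \<in> supp_mat n {(i, j) | j. (j, l) \<in> rad_step i}"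
        by (rule skew_mult_supp_mat[OF mat_unit_supp_mat[of i l "{(i, l)}"] T])
          (use 1(2) in \<open>auto simp: rad_step_def\<close>)
      also have "\<dots> \<subseteq> I"
      proof (rule supp_mat_subset_left_ideal[OF I])
        fix p j assume "(p, j) \<in> {(i, j) | j. (j, l) \<in> rad_step i}"
        then have p: "p = i" and jl: "(j, l) \<in> rad_step i" by auto
        have "(i, j) \<in> nuc n c"
          using jl nuc_trans[of i l n c j] by (auto simp: rad_step_def nuc_rad_def)
        then show "mat_unit n p j \<in> I" unfolding p by (rule 1(1)[OF jl])
      qed
      finally show "skew_mult n c (mat_unit n i l) T \<in> I" .
    qed
    finally show ?case .
  qed
  have "supp_mat n (nuc_eq n c) \<subseteq> I"
    by (rule supp_mat_subset_left_ideal[OF I]) (use units nuc_eq_subset in blast)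
  then show ?thesis using one_supp_mat by blast
qed

text \<open>Otherwise the sum of \<open>I\<close> and the radical part is a strictly larger left
  ideal, hence everything, and \<open>1 = M + T\<close>. Then \<open>left_ideal_plus_rad_one\<close>
  puts \<open>1\<close> into \<open>I\<close>, which is proper.\<close>

lemma supp_rad_subset_maximal:
  assumes I: "maximal_left_ideal I N"
  shows "supp_mat n (nuc_rad n c) \<subseteq> I"
proof (rule ccontr)
  assume not: "\<not> supp_mat n (nuc_rad n c) \<subseteq> I"
  have L: "left_ideal I N" and proper: "I \<noteq> carrier N"
    and max: "\<And>J. left_ideal J N \<Longrightarrow> I \<subseteq> J \<Longrightarrow> J = I \<or> J = carrier N"
    using I by (auto simp: maximal_left_ideal_def)
  let ?T = "supp_mat n (nuc_rad n c)"
  let ?J = "{X + Y | X Y. X \<in> I \<and> Y \<in> ?T}"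
  have Ic: "X \<in> I \<Longrightarrow> X \<in> carrier_mat n n" for X
    using left_idealD(1)[OF L] supp_mat_carrier by blast
  have Tc: "X \<in> ?T \<Longrightarrow> X \<in> carrier_mat n n" for X by (rule supp_mat_carrier)
  have "left_ideal ?J N"
  proof (rule left_idealI)
    show "?J \<subseteq> supp_mat n (nuc n c)"
      using left_idealD(1)[OF L] left_idealD(1)[OF left_ideal_rad] by (auto intro: add_supp_mat)
    have "0\<^sub>m n n = 0\<^sub>m n n + (0\<^sub>m n n :: 'a mat)" by simp
    then show "0\<^sub>m n n \<in> ?J" using left_idealD(2)[OF L] zero_supp_mat by blast
    show "X + Y \<in> ?J" if XJ: "X \<in> ?J" and YJ: "Y \<in> ?J" for X Y
    proof -
      obtain X1 X2 Y1 Y2 where XY: "X = X1 + X2" "Y = Y1 + Y2"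
        and mem: "X1 \<in> I" "X2 \<in> ?T" "Y1 \<in> I" "Y2 \<in> ?T" using XJ YJ by blast
      have "X + Y = (X1 + Y1) + (X2 + Y2)"
        unfolding XY using Ic[OF mem(1)] Tc[OF mem(2)] Ic[OF mem(3)] Tc[OF mem(4)]
        by (intro eq_matI) (auto simp: add_ac)
      then show ?thesis
        using left_idealD(3)[OF L mem(1,3)] add_supp_mat[OF mem(2,4)] by blast
    qed
    show "skew_mult n c R X \<in> ?J" if R: "R \<in> supp_mat n (nuc n c)" and X: "X \<in> ?J" for R X
    proof -
      obtain X1 X2 where X: "X = X1 + X2" and mem: "X1 \<in> I" "X2 \<in> ?T" using X by blast
      have "skew_mult n c R X = skew_mult n c R X1 + skew_mult n c R X2"
        unfolding X by (rule skew_mult_add_right[OF supp_mat_carrier[OF R] Ic[OF mem(1)] Tc[OF mem(2)]])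
      then show ?thesis
        using left_idealD(4)[OF L R mem(1)] left_idealD(4)[OF left_ideal_rad R mem(2)] by blast
    qed
  qed
  moreover have "I \<subseteq> ?J"
  proof
    fix X assume X: "X \<in> I"
    then have "X = X + 0\<^sub>m n n" using Ic by simp
    then show "X \<in> ?J" using X zero_supp_mat by blast
  qed
  moreover have "?J \<noteq> I"
  proof -
    obtain Y where Y: "Y \<in> ?T" "Y \<notin> I" using not by blast
    have "Y = 0\<^sub>m n n + Y" using Tc[OF Y(1)] by simp
    then have "Y \<in> ?J" using Y(1) left_idealD(2)[OF L] by blast
    then show ?thesis using Y(2) by blast
  qed
  ultimately have "?J = carrier N" using max by blast
  moreover have "1\<^sub>m n \<in> carrier N"
    using one_supp_mat supp_mat_mono[OF nuc_eq_subset] unfolding carrier_N by blast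
  ultimately obtain M T where "M \<in> I" "T \<in> ?T" "1\<^sub>m n = M + T" by blast
  then have "1\<^sub>m n \<in> I" by (rule left_ideal_plus_rad_one[OF L])
  then show False using left_ideal_one[OF L] proper unfolding carrier_N by blast
qed

lemma jacobson_radical_nucleus: "jacobson_radical N = supp_mat n (nuc_rad n c)"
proof
  show "supp_mat n (nuc_rad n c) \<subseteq> jacobson_radical N"
    using supp_rad_subset_maximal supp_mat_mono[OF nuc_rad_subset]
    unfolding jacobson_radical_def carrier_N by blast
qed (rule jacobson_radical_subset)

section \<open>The vector space decomposition and the partition subalgebra\<close>

lemma direct_sum_nucleus:
  "internal_direct_sum N (supp_mat n (nuc_eq n c)) (jacobson_radical N)"
  unfolding internal_direct_sum_def
proof (intro conjI)
  interpret vectorspace class_ring N by (rule vectorspace_N)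
  show "VectorSpace.subspace class_ring (supp_mat n (nuc_eq n c)) N"
    using subspace_supp_mat[OF nuc_eq_subset] by (simp add: nucleus_skew)
  show "VectorSpace.subspace class_ring (jacobson_radical N) N"
    unfolding jacobson_radical_nucleus unfolding nucleus_skew
    by (rule subspace_supp_mat[OF nuc_rad_subset])
  show "supp_mat n (nuc_eq n c) \<inter> jacobson_radical N = {\<zero>\<^bsub>N\<^esub>}"
  proof -
    have "X = 0\<^sub>m n n" if "X \<in> supp_mat n (nuc_eq n c)" "X \<in> supp_mat n (nuc_rad n c)" for X
      using supp_matD[OF that(1)] supp_matD[OF that(2)] supp_mat_carrier[OF that(1)]
      by (intro eq_matI) (auto simp: nuc_rad_def)
    then show ?thesis by (auto simp: jacobson_radical_nucleus)
  qed
  show "submodule_sum (supp_mat n (nuc_eq n c)) (jacobson_radical N) = carrier N"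
    unfolding submodule_sum_def jacobson_radical_nucleus carrier_N
  proof (intro equalityI subsetI)
    fix X :: "'a mat" assume X: "X \<in> supp_mat n (nuc n c)"
    let ?Y = "mat n n (\<lambda>p. if p \<in> nuc_eq n c then X $$ p else 0)"
    let ?Z = "mat n n (\<lambda>p. if p \<in> nuc_eq n c then 0 else X $$ p)"
    have "X = ?Y + ?Z" using supp_mat_carrier[OF X] by (intro eq_matI) auto
    moreover have "?Y \<in> supp_mat n (nuc_eq n c)" by (rule supp_matI) (auto split: if_splits)
    moreover have "?Z \<in> supp_mat n (nuc_rad n c)"
      by (rule supp_matI) (use supp_matD[OF X] in \<open>auto simp: nuc_rad_def split: if_splits\<close>)
    ultimately show "X \<in> (\<lambda>(x, y). x \<oplus>\<^bsub>N\<^esub> y) `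
        {(x, y). x \<in> supp_mat n (nuc_eq n c) \<and> y \<in> supp_mat n (nuc_rad n c)}"
      by (intro image_eqI[of _ _ "(?Y, ?Z)"]) simp_all
  next
    fix X assume "X \<in> (\<lambda>(x, y). x \<oplus>\<^bsub>N\<^esub> y) `
        {(x, y). x \<in> supp_mat n (nuc_eq n c) \<and> y \<in> supp_mat n (nuc_rad n c)}"
    then obtain Y Z where X: "X = Y + Z"
      and YZ: "Y \<in> supp_mat n (nuc_eq n c)" "Z \<in> supp_mat n (nuc_rad n c)" by auto
    show "X \<in> supp_mat n (nuc n c)"
      unfolding X using YZ supp_mat_mono[OF nuc_eq_subset] supp_mat_mono[OF nuc_rad_subset]
      by (intro add_supp_mat) blast+
  qed
qed

lemma lin_span_nuc_eq:
  "lin_span (skew_matrix_algebra n c) {mat_unit n i j | i j.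
      i < n \<and> j < n \<and> mat_unit n i j \<in> nucleus (skew_matrix_algebra n c) \<and> c i j i \<noteq> 0}
   = supp_mat n (nuc_eq n c)"
proof -
  have "(i < n \<and> j < n \<and> mat_unit n i j \<in> nucleus (skew_matrix_algebra n c) \<and> c i j i \<noteq> 0)
    \<longleftrightarrow> (i, j) \<in> nuc_eq n c" for i j
    using mat_unit_in_nucleus[of i n j c] nuc_less[of i j n c] by (auto simp: nuc_eq_def)
  then show ?thesis
    using span_mat_units[OF order_trans[OF nuc_eq_subset nuc_subset]] by (simp only:)
qed

lemma partition_subalgebra_nuc_eq: "partition_subalgebra n c (supp_mat n (nuc_eq n c))"
  unfolding partition_subalgebra_def unital_subalgebra_def
proof (intro conjI exI ballI)
  show "VectorSpace.subspace class_ring (supp_mat n (nuc_eq n c)) (skew_matrix_algebra n c)"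
    by (rule subspace_skew)
  show "\<one>\<^bsub>skew_matrix_algebra n c\<^esub> \<in> supp_mat n (nuc_eq n c)" using one_supp_mat by simp
  show "x \<otimes>\<^bsub>skew_matrix_algebra n c\<^esub> y \<in> supp_mat n (nuc_eq n c)"
    if "x \<in> supp_mat n (nuc_eq n c)" "y \<in> supp_mat n (nuc_eq n c)" for x y
    using skew_mult_supp_mat[OF that] nuc_eq_trans by simp
  show "equiv {..<n} (nuc_eq n c)" by (rule equiv_nuc_eq)
  show "supp_mat n (nuc_eq n c) =
      lin_span (skew_matrix_algebra n c) {mat_unit n i j | i j. (i, j) \<in> nuc_eq n c}"
    by (rule span_mat_units[OF order_trans[OF nuc_eq_subset nuc_subset], symmetric])
qed

end

section \<open>Operations of direct sums of matrix algebras, and block coordinates for an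
  equivalence relation\<close>

lemma matrix_algebras_sum_carrier:
  "Xs \<in> carrier (matrix_algebras_sum ms :: ('a :: field, 'a mat list) module) \<longleftrightarrow>
    list_all2 (\<lambda>X m. X \<in> carrier_mat m m) Xs ms"
proof -
  have "carrier (matrix_algebras_sum ms :: ('a, 'a mat list) module) =
      carrier (RDirProd_list (map (\<lambda>m. ring_mat TYPE('a) m ()) ms))"
    by (simp add: matrix_algebras_sum_def ring.defs)
  moreover have "Xs \<in> carrier (RDirProd_list (map (\<lambda>m. ring_mat TYPE('a) m ()) ms)) \<longleftrightarrow>
      list_all2 (\<lambda>X m. X \<in> carrier_mat m m) Xs ms"
    by (induction ms arbitrary: Xs)
      (auto simp: RDirProd_list_carrier ring_mat_def list_all2_Cons2)
  ultimately show ?thesis by simp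
qed

text \<open>Prepending the first component is a ring homomorphism from the binary product to the
  list product, so the operations can be read off by recursion. Homomorphism laws hold on the
  carriers, hence the size conditions.\<close>

lemma matrix_algebras_sum_mult_add:
  assumes "list_all2 (\<lambda>X m. X \<in> carrier_mat m m) Xs ms"
    and "list_all2 (\<lambda>X m. X \<in> carrier_mat m m) Ys ms"
  shows "Xs \<otimes>\<^bsub>matrix_algebras_sum ms\<^esub> Ys = map2 (*) Xs (Ys :: 'a :: field mat list)"
    and "Xs \<oplus>\<^bsub>matrix_algebras_sum ms\<^esub> Ys = map2 (+) Xs Ys"
proof -
  let ?R = "\<lambda>ms. RDirProd_list (map (\<lambda>m. ring_mat TYPE('a) m ()) ms)"
  have carrier: "Zs \<in> carrier (?R ms) \<longleftrightarrow> list_all2 (\<lambda>X m. X \<in> carrier_mat m m) Zs ms"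
    for Zs :: "'a mat list" and ms
    using matrix_algebras_sum_carrier[of Zs ms] by (simp add: matrix_algebras_sum_def ring.defs)
  have "Xs \<otimes>\<^bsub>?R ms\<^esub> Ys = map2 (*) Xs Ys \<and> Xs \<oplus>\<^bsub>?R ms\<^esub> Ys = map2 (+) Xs Ys"
    using assms
  proof (induction ms arbitrary: Xs Ys rule: list.induct)
    case Nil
    then show ?case by (simp add: monoid.defs)
  next
    case (Cons m ms)
    obtain X Xs' Y Ys' where XY: "Xs = X # Xs'" "Ys = Y # Ys'"
      and mem: "X \<in> carrier_mat m m" "Y \<in> carrier_mat m m"
      and tl: "list_all2 (\<lambda>X m. X \<in> carrier_mat m m) Xs' ms"
        "list_all2 (\<lambda>X m. X \<in> carrier_mat m m) Ys' ms"
      using Cons.prems by (auto simp: list_all2_Cons2)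
    let ?P = "RDirProd (ring_mat TYPE('a) m ()) (?R ms)"
    have hom: "(\<lambda>(a, as). a # as) \<in> Ring.ring_hom ?P (?R (m # ms))"
      using RDirProd_list_hom1[of "ring_mat TYPE('a) m ()" "map (\<lambda>m. ring_mat TYPE('a) m ()) ms"]
      by simp
    have P: "(X, Xs') \<in> carrier ?P" "(Y, Ys') \<in> carrier ?P"
      using mem tl carrier by (auto simp: RDirProd_carrier ring_mat_def)
    have "Xs \<otimes>\<^bsub>?R (m # ms)\<^esub> Ys = (\<lambda>(a, as). a # as) ((X, Xs') \<otimes>\<^bsub>?P\<^esub> (Y, Ys'))"
      using Ring.ring_hom_mult[OF hom P] XY by simp
    moreover have "Xs \<oplus>\<^bsub>?R (m # ms)\<^esub> Ys = (\<lambda>(a, as). a # as) ((X, Xs') \<oplus>\<^bsub>?P\<^esub> (Y, Ys'))"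
      using Ring.ring_hom_add[OF hom P] XY by simp
    moreover have "(X, Xs') \<otimes>\<^bsub>?P\<^esub> (Y, Ys') = (X * Y, Xs' \<otimes>\<^bsub>?R ms\<^esub> Ys')"
      "(X, Xs') \<oplus>\<^bsub>?P\<^esub> (Y, Ys') = (X + Y, Xs' \<oplus>\<^bsub>?R ms\<^esub> Ys')"
      by (simp_all add: RDirProd_def DirProd_def monoid.defs ring_mat_def)
    ultimately show ?case
      using Cons.IH[OF tl] XY by simp
  qed
  then show "Xs \<otimes>\<^bsub>matrix_algebras_sum ms\<^esub> Ys = map2 (*) Xs Ys"
    "Xs \<oplus>\<^bsub>matrix_algebras_sum ms\<^esub> Ys = map2 (+) Xs Ys"
    by (simp_all add: matrix_algebras_sum_def ring.defs)
qed

lemma matrix_algebras_sum_one: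
  "\<one>\<^bsub>matrix_algebras_sum ms\<^esub> = (map 1\<^sub>m ms :: 'a :: field mat list)"
proof -
  have "foldr (\<lambda>R. (#) \<one>\<^bsub>R\<^esub>) (map (\<lambda>m. ring_mat TYPE('a) m ()) ms) [] = map 1\<^sub>m ms"
    by (induction ms) (auto simp: ring_mat_def)
  then show ?thesis
    by (simp add: matrix_algebras_sum_def ring.defs RDirProd_list_one)
qed

lemma matrix_algebras_sum_smult:
  "a \<odot>\<^bsub>matrix_algebras_sum ms\<^esub> Xs = map (\<lambda>X. a \<cdot>\<^sub>m X) (Xs :: 'a :: field mat list)"
  by (simp add: matrix_algebras_sum_def ring.defs)

text \<open>The classes are numbered and each is sorted into a list. \<open>K i\<close> is the
  number of the class of \<open>i\<close> and \<open>P i\<close> its place there, so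
  \<open>(K i, P i)\<close> serves as block coordinates of \<open>i\<close>.\<close>

lemma equiv_class_lists:
  assumes equiv: "equiv {..<n} r"
  obtains xss :: "nat list list" and K P :: "nat \<Rightarrow> nat"
  where "\<forall>xs \<in> set xss. length xs \<ge> 1" "sum_list (map length xss) = n"
    and "\<forall>i<n. K i < length xss \<and> P i < length (xss ! K i) \<and> xss ! K i ! P i = i"
    and "\<forall>k<length xss. \<forall>a<length (xss ! k).
      xss ! k ! a < n \<and> K (xss ! k ! a) = k \<and> P (xss ! k ! a) = a"
    and "\<forall>i<n. \<forall>j<n. (i, j) \<in> r \<longleftrightarrow> K i = K j"
proof -
  have fin: "finite ({..<n} // r)"
    by (rule finite_quotient) (use equiv equivE in auto)
  then obtain Cs where Cs: "set Cs = {..<n} // r" "distinct Cs"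
    using finite_distinct_list by blast
  have Cfin: "finite C" and Csub: "C \<subseteq> {..<n}" if "C \<in> set Cs" for C
  proof -
    show "C \<subseteq> {..<n}" using that Cs Union_quotient[OF equiv] by blast
    then show "finite C" by (rule finite_subset) simp
  qed
  define xss where "xss = map sorted_list_of_set Cs"
  have set_nth: "set (xss ! k) = Cs ! k" "distinct (xss ! k)" if "k < length Cs" for k
    using Cfin that by (simp_all add: xss_def)
  have len: "length xss = length Cs" by (simp add: xss_def)
  have "\<exists>k<length Cs. Cs ! k = r `` {i}" if "i < n" for i
    using that Cs(1) by (metis in_set_conv_nth lessThan_iff quotientI)
  then obtain K where K: "\<And>i. i < n \<Longrightarrow> K i < length Cs \<and> Cs ! K i = r `` {i}" by metis
  have "\<exists>a<length (xss ! K i). xss ! K i ! a = i" if "i < n" for i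
  proof -
    have "i \<in> set (xss ! K i)"
      using K[OF that] set_nth(1)[of "K i"] equiv_class_self[OF equiv] that by simp
    then show ?thesis by (simp add: in_set_conv_nth)
  qed
  then obtain P where P: "\<And>i. i < n \<Longrightarrow> P i < length (xss ! K i) \<and> xss ! K i ! P i = i" by metis
  have KP: "xss ! k ! a < n \<and> K (xss ! k ! a) = k \<and> P (xss ! k ! a) = a"
    if k: "k < length xss" and a: "a < length (xss ! k)" for k a
  proof -
    let ?x = "xss ! k ! a"
    have k': "k < length Cs" using k len by simp
    have mem: "?x \<in> Cs ! k" using nth_mem[OF a] set_nth(1)[OF k'] by simp
    then have x: "?x < n" using Csub[OF nth_mem[OF k']] by auto
    have q: "Cs ! k \<in> {..<n} // r" using nth_mem[OF k'] Cs(1) by simp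
    have q': "Cs ! K ?x \<in> {..<n} // r" using nth_mem[of "K ?x" Cs] K[OF x] Cs(1) by simp
    have "?x \<in> Cs ! K ?x" using K[OF x] equiv_class_self[OF equiv] x by simp
    \<comment> \<open>Two classes that share \<open>?x\<close> coincide; as \<open>Cs\<close> is
      distinct, their numbers agree.\<close>
    then have "Cs ! k = Cs ! K ?x" using quotient_disj[OF equiv q q'] mem by blast
    then have Kk: "K ?x = k"
      using nth_eq_iff_index_eq[OF Cs(2) k', of "K ?x"] K[OF x] by metis
    have "P ?x < length (xss ! k)" "xss ! k ! P ?x = ?x" using P[OF x] unfolding Kk by auto
    then have "P ?x = a"
      using nth_eq_iff_index_eq[OF set_nth(2)[OF k'] _ a] by blast
    then show ?thesis using x Kk by simp
  qed
  show ?thesis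
  proof (rule that[of xss K P]; (intro ballI allI impI)?)
    show "length xs \<ge> 1" if "xs \<in> set xss" for xs
    proof -
      obtain C where C: "C \<in> set Cs" "xs = sorted_list_of_set C"
        using \<open>xs \<in> set xss\<close> by (auto simp: xss_def)
      have "C \<noteq> {}" using C(1) Cs(1) in_quotient_imp_non_empty[OF equiv] by blast
      then have "card C > 0" using Cfin[OF C(1)] by (simp add: card_gt_0_iff)
      then show ?thesis using C(2) by simp
    qed
    have "sum_list (map length xss) = sum card ({..<n} // r)"
      using Cs by (simp add: xss_def o_def sum_list_distinct_conv_sum_set)
    also have "\<dots> = card (\<Union> ({..<n} // r))"
      using quotient_disj[OF equiv] Cfin Cs(1)
      by (intro card_Union_disjoint[symmetric]) (auto simp: pairwise_def disjnt_def)
    finally show "sum_list (map length xss) = n" using Union_quotient[OF equiv] by simp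
    show "K i < length xss \<and> P i < length (xss ! K i) \<and> xss ! K i ! P i = i" if "i < n" for i
      using K[OF that] P[OF that] len by simp
    show "xss ! k ! a < n \<and> K (xss ! k ! a) = k \<and> P (xss ! k ! a) = a"
      if "k < length xss" "a < length (xss ! k)" for k a
      using KP[OF that] .
    show "(i, j) \<in> r \<longleftrightarrow> K i = K j" if "i < n" "j < n" for i j
    proof -
      have "(i, j) \<in> r \<longleftrightarrow> r `` {i} = r `` {j}"
        using eq_equiv_class_iff[OF equiv] that by simp
      also have "\<dots> \<longleftrightarrow> K i = K j"
        using K[OF that(1)] K[OF that(2)] nth_eq_iff_index_eq[OF Cs(2)] by metis
      finally show ?thesis .
    qed
  qed
qed

section \<open>The span of the related units as a sum of matrix algebras\<close>

context reduced_skew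
begin

text \<open>
  On an equivalence class the nuclear cocycle identity \<open>c\<^sub>0\<^sub>i\<^sub>j c\<^sub>0\<^sub>j\<^sub>l = c\<^sub>0\<^sub>i\<^sub>l c\<^sub>i\<^sub>j\<^sub>l\<close> makes \<open>c\<close> a
  coboundary, so that rescaling the unit \<open>e\<^sub>i\<^sub>j\<close> by \<open>c\<^sub>0\<^sub>i\<^sub>j\<close> turns the product into the usual one.
\<close>
lemma nuc_eq_iso_matrix_algebras:
  assumes n: "n \<ge> 1"
  shows "\<exists>ms. (\<forall>m \<in> set ms. m \<ge> 1) \<and> sum_list ms = n \<and>
    algebra_iso ((skew_matrix_algebra n c)\<lparr>carrier := supp_mat n (nuc_eq n c)\<rparr>)
      (matrix_algebras_sum ms) \<noteq> {}"
proof -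
  obtain xss K P
    where pos: "\<forall>xs \<in> set xss. length xs \<ge> 1" and sum: "sum_list (map length xss) = n"
      and KP': "\<forall>i<n. K i < length xss \<and> P i < length (xss ! K i) \<and> xss ! K i ! P i = i"
      and nth': "\<forall>k<length xss. \<forall>a<length (xss ! k).
        xss ! k ! a < n \<and> K (xss ! k ! a) = k \<and> P (xss ! k ! a) = a"
      and rel': "\<forall>i<n. \<forall>j<n. (i, j) \<in> nuc_eq n c \<longleftrightarrow> K i = K j"
    by (rule equiv_class_lists[OF equiv_nuc_eq])
  note KP = KP'[rule_format] and nth = nth'[rule_format] and rel = rel'[rule_format]
  define block :: "'a mat \<Rightarrow> nat list \<Rightarrow> 'a mat" where
    "block X xs = mat (length xs) (length xs)
       (\<lambda>(a, b). c 0 (xs ! a) (xs ! b) * X $$ (xs ! a, xs ! b))" for X xs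
  define \<phi> where "\<phi> X = map (block X) xss" for X
  \<comment> \<open>The inverse map reads entry \<open>(i, j)\<close> from the block
    \<open>K i\<close> at \<open>(P i, P j)\<close> and undoes the rescaling.\<close>
  define \<psi> where "\<psi> Zs = mat n n (\<lambda>(i, j). if (i, j) \<in> nuc_eq n c
    then inverse (c 0 i j) * Zs ! K i $$ (P i, P j) else 0)" for Zs :: "'a mat list"
  let ?ms = "map length xss"
  let ?S = "supp_mat n (nuc_eq n c) :: 'a mat set"
  let ?A = "(skew_matrix_algebra n c)\<lparr>carrier := ?S\<rparr>"
  let ?B = "matrix_algebras_sum ?ms :: ('a, 'a mat list) module"
  have carrier_B: "Zs \<in> carrier ?B \<longleftrightarrow> length Zs = length xss \<and>
      (\<forall>k<length xss. Zs ! k \<in> carrier_mat (length (xss ! k)) (length (xss ! k)))" for Zs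
    by (auto simp: matrix_algebras_sum_carrier list_all2_conv_all_nth)
  have \<phi>_carrier: "\<phi> X \<in> carrier ?B" for X
    by (simp add: carrier_B \<phi>_def block_def)
  have \<phi>_all2: "list_all2 (\<lambda>X m. X \<in> carrier_mat m m) (\<phi> X) ?ms" for X
    using \<phi>_carrier[of X] by (simp add: matrix_algebras_sum_carrier)
  have len\<phi>: "length (\<phi> X) = length xss" for X by (simp add: \<phi>_def)
  \<comment> \<open>The base index \<open>0\<close> is in range because
    \<open>n \<ge> 1\<close>.\<close>
  have nz: "c 0 i j \<noteq> 0" if "(i, j) \<in> nuc_eq n c" for i j
    using nuc_eq_nonzero(2)[OF that] n by simp
  have add: "\<phi> (X + Y) = \<phi> X \<oplus>\<^bsub>?B\<^esub> \<phi> Y" if "X \<in> ?S" "Y \<in> ?S" for X Y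
  proof -
    have "block (X + Y) xs = block X xs + block Y xs" if "xs \<in> set xss" for xs
    proof -
      obtain k where k: "k < length xss" "xs = xss ! k"
        using \<open>xs \<in> set xss\<close> by (auto simp: in_set_conv_nth)
      show ?thesis
        using nth[OF k(1)] k(2) supp_mat_carrier[OF \<open>X \<in> ?S\<close>] supp_mat_carrier[OF \<open>Y \<in> ?S\<close>]
        by (intro eq_matI) (auto simp: block_def ring_distribs)
    qed
    then show ?thesis
      unfolding matrix_algebras_sum_mult_add(2)[OF \<phi>_all2 \<phi>_all2]
      by (auto simp: \<phi>_def map2_map_map)
  qed
  have smult: "\<phi> (a \<cdot>\<^sub>m X) = a \<odot>\<^bsub>?B\<^esub> \<phi> X" if "X \<in> ?S" for a X
  proof -
    have "block (a \<cdot>\<^sub>m X) xs = a \<cdot>\<^sub>m block X xs" if "xs \<in> set xss" for xs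
    proof -
      obtain k where k: "k < length xss" "xs = xss ! k"
        using \<open>xs \<in> set xss\<close> by (auto simp: in_set_conv_nth)
      show ?thesis
        using nth[OF k(1)] k(2) supp_mat_carrier[OF \<open>X \<in> ?S\<close>]
        by (intro eq_matI) (auto simp: block_def)
    qed
    then show ?thesis
      unfolding matrix_algebras_sum_smult by (auto simp: \<phi>_def)
  qed
  have one: "\<phi> (1\<^sub>m n) = \<one>\<^bsub>?B\<^esub>"
  proof -
    have "block (1\<^sub>m n) xs = 1\<^sub>m (length xs)" if "xs \<in> set xss" for xs
    proof -
      obtain k where k: "k < length xss" "xs = xss ! k"
        using \<open>xs \<in> set xss\<close> by (auto simp: in_set_conv_nth)
      have "xs ! a = xs ! b \<longleftrightarrow> a = b" if "a < length xs" "b < length xs" for a b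
        using nth[OF k(1)] that unfolding k(2) by metis
      then show ?thesis
        using nth[OF k(1)] k(2) n
        by (intro eq_matI) (auto simp: block_def)
    qed
    then show ?thesis
      unfolding matrix_algebras_sum_one by (auto simp: \<phi>_def)
  qed
  have mult: "\<phi> (skew_mult n c X Y) = \<phi> X \<otimes>\<^bsub>?B\<^esub> \<phi> Y" if X: "X \<in> ?S" and Y: "Y \<in> ?S" for X Y
  proof -
    have "block (skew_mult n c X Y) xs = block X xs * block Y xs" if "xs \<in> set xss" for xs
    proof -
      obtain k where k: "k < length xss" and xs: "xs = xss ! k"
        using \<open>xs \<in> set xss\<close> by (auto simp: in_set_conv_nth)
      note nthk = nth[OF k, folded xs]
      \<comment> \<open>With \<open>inj\<close> below, \<open>xs\<close> enumerates class
        \<open>k\<close> bijectively, so a sum over the class becomes a sum over the block index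
        \<open>d\<close>.\<close>
      have img: "(!) xs ` {..<length xs} = {j. j < n \<and> K j = k}"
      proof (intro equalityI subsetI)
        show "j \<in> (!) xs ` {..<length xs}" if "j \<in> {j. j < n \<and> K j = k}" for j
          using KP[of j] that unfolding xs by (auto intro!: image_eqI[of j _ "P j"])
      qed (use nthk in auto)
      have inj: "inj_on ((!) xs) {..<length xs}"
        using nthk by (intro inj_onI) (metis lessThan_iff)
      have "(\<Sum>j<n. c i j l * (X $$ (i, j) * Y $$ (j, l))) * c 0 i l =
          (\<Sum>d<length xs. (c 0 i (xs ! d) * X $$ (i, xs ! d)) * (c 0 (xs ! d) l * Y $$ (xs ! d, l)))"
        if i: "i < n" "K i = k" and l: "l < n" for i l
      proof -
        have "(\<Sum>j<n. c i j l * (X $$ (i, j) * Y $$ (j, l))) * c 0 i l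
          = (\<Sum>j<n. c 0 i l * c i j l * (X $$ (i, j) * Y $$ (j, l)))"
          by (simp add: sum_distrib_left sum_distrib_right mult_ac)
        \<comment> \<open>\<open>X\<close> vanishes at \<open>(i, j)\<close> unless \<open>j\<close>
          lies in the class of \<open>i\<close>.\<close>
        also have "\<dots> = (\<Sum>j | j < n \<and> K j = k. c 0 i l * c i j l * (X $$ (i, j) * Y $$ (j, l)))"
          using supp_matD[OF X i(1)] rel[OF i(1)] i(2)
          by (intro sum.mono_neutral_right) auto
        also have "\<dots> = (\<Sum>j | j < n \<and> K j = k. (c 0 i j * X $$ (i, j)) * (c 0 j l * Y $$ (j, l)))"
        proof (rule sum.cong[OF refl])
          fix j assume j: "j \<in> {j. j < n \<and> K j = k}"
          then have "(i, j) \<in> nuc_eq n c" using rel[OF i(1), of j] i(2) by simp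
          then have "(i, j) \<in> nuc n c" using nuc_eq_subset by blast
          from nuc_cocycle(2)[OF this, of 0 l]
          have "c 0 i l * c i j l = c 0 i j * c 0 j l" using n l by simp
          then show "c 0 i l * c i j l * (X $$ (i, j) * Y $$ (j, l)) =
              (c 0 i j * X $$ (i, j)) * (c 0 j l * Y $$ (j, l))"
            by (simp only: mult_ac)
        qed
        also have "\<dots> = (\<Sum>d<length xs.
            (c 0 i (xs ! d) * X $$ (i, xs ! d)) * (c 0 (xs ! d) l * Y $$ (xs ! d, l)))"
          unfolding img[symmetric] sum.reindex[OF inj] by simp
        finally show ?thesis .
      qed
      then show ?thesis
        using nthk
        by (intro eq_matI)
          (auto simp: block_def scalar_prod_def mult.commute atLeast0LessThan intro!: sum.cong)
    qed
    then show ?thesis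
      unfolding matrix_algebras_sum_mult_add(1)[OF \<phi>_all2 \<phi>_all2]
      by (auto simp: \<phi>_def map2_map_map)
  qed
  have "bij_betw \<phi> ?S (carrier ?B)"
  proof (rule bij_betwI[where g = \<psi>])
    show "\<phi> \<in> ?S \<rightarrow> carrier ?B" using \<phi>_carrier by blast
    show "\<psi> \<in> carrier ?B \<rightarrow> ?S" by (auto simp: \<psi>_def intro!: supp_matI split: if_splits)
    show "\<psi> (\<phi> X) = X" if "X \<in> ?S" for X
    proof (rule eq_matI)
      fix i j assume "i < dim_row X" "j < dim_col X"
      then have ij: "i < n" "j < n" using supp_mat_carrier[OF that] by auto
      show "\<psi> (\<phi> X) $$ (i, j) = X $$ (i, j)"
      proof (cases "(i, j) \<in> nuc_eq n c")
        case True
        then have "K i = K j" using rel ij by simp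
        then show ?thesis
          using True ij KP[OF ij(1)] KP[OF ij(2)] nz[OF True]
          by (simp add: \<psi>_def \<phi>_def block_def)
      next
        case False
        then show ?thesis using supp_matD[OF that ij] ij by (auto simp: \<psi>_def)
      qed
    qed (use supp_mat_carrier[OF that] in \<open>auto simp: \<psi>_def\<close>)
    show "\<phi> (\<psi> Zs) = Zs" if Zs: "Zs \<in> carrier ?B" for Zs
    proof (rule nth_equalityI)
      show "length (\<phi> (\<psi> Zs)) = length Zs" using Zs by (simp add: carrier_B len\<phi>)
      fix k assume "k < length (\<phi> (\<psi> Zs))"
      then have k: "k < length xss" by (simp add: len\<phi>)
      have "block (\<psi> Zs) (xss ! k) = Zs ! k"
      proof (rule eq_matI)
        fix a b assume "a < dim_row (Zs ! k)" "b < dim_col (Zs ! k)"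
        then have ab: "a < length (xss ! k)" "b < length (xss ! k)"
          using Zs k by (auto simp: carrier_B)
        have "(xss ! k ! a, xss ! k ! b) \<in> nuc_eq n c"
          using nth[OF k ab(1)] nth[OF k ab(2)] rel by simp
        then show "block (\<psi> Zs) (xss ! k) $$ (a, b) = Zs ! k $$ (a, b)"
          using nth[OF k ab(1)] nth[OF k ab(2)] ab nz by (simp add: block_def \<psi>_def)
      qed (use Zs k in \<open>auto simp: carrier_B block_def\<close>)
      then show "\<phi> (\<psi> Zs) ! k = Zs ! k" using k by (simp add: \<phi>_def)
    qed
  qed
  then have "\<phi> \<in> ring_iso ?A ?B"
    using \<phi>_carrier mult add one by (auto simp: ring_iso_def intro!: ring_hom_memI)
  moreover have "\<phi> \<in> LinearCombinations.module_hom class_ring ?A ?B"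
    using \<phi>_carrier add smult by (auto simp: LinearCombinations.module_hom_def)
  ultimately have "algebra_iso ?A ?B \<noteq> {}" by (auto simp: algebra_iso_def)
  moreover have "\<forall>m \<in> set ?ms. m \<ge> 1" using pos by auto
  ultimately show ?thesis using sum by blast
qed

end

theorem theorem11p13:
  fixes n :: nat and c :: "nat \<Rightarrow> nat \<Rightarrow> nat \<Rightarrow> 'a :: field"
  defines "A \<equiv> skew_matrix_algebra n c"
  defines "S \<equiv> lin_span A {mat_unit n i j | i j.
                 i < n \<and> j < n \<and> mat_unit n i j \<in> nucleus A \<and> c i j i \<noteq> 0}"
  assumes "n \<ge> 1"
    and "reduced_skew_set n c"
  shows "internal_direct_sum (nucleus_algebra A) S (jacobson_radical (nucleus_algebra A))
    \<and> partition_subalgebra n c S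
    \<and> (\<exists>ms. (\<forall>m \<in> set ms. m \<ge> 1) \<and> sum_list ms = n \<and>
          algebra_iso (A\<lparr>carrier := S\<rparr>) (matrix_algebras_sum ms) \<noteq> {})"
proof -
  interpret reduced_skew n c by (rule reduced_skew.intro) fact
  have S: "S = supp_mat n (nuc_eq n c)"
    unfolding S_def A_def by (rule lin_span_nuc_eq)
  show ?thesis
    unfolding S unfolding A_def
    using direct_sum_nucleus partition_subalgebra_nuc_eq nuc_eq_iso_matrix_algebras[OF \<open>n \<ge> 1\<close>]
    by blast
qed

end
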